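(* Let $\beta\in(0,1)$ and let $(\delta_d)_{0\le d<D}$ be positive numbers such that the following smoothness assumption holds along an optimal path: there is a path $i_0,i_1,\dots,i_D$ from the root to a leaf with $\mu_{i_d}=\mu^*$ for all $d$, such that for every $d<D$ and every leaf $j\in\mathcal L(i_d)$, $\mu^*-\mu_j\le\delta_d$. Consider the algorithm BAST (defined in the context) with parameters $(\delta_d)$ and $\beta$. Let $I$ denote the set of (non-leaf) nodes $i$ such that $\Delta_i>\delta_{d_i}$, where $d_i$ is the depth of node $i$. Define recursively numbers $N_i$ for each node $i$ with $\Delta_i>0$: - if $i$ is a leaf, $N_i=\dfrac{6\log(4N\beta^{-1}/\Delta_i^2)}{\Delta_i^2}$; - if $i$ is not a leaf, with children $i_1,i_2$, $$N_i=\begin{cases}N_{i_1}+N_{i_2}, & \text{if } i\notin I,\\[1mm] \min\left(N_{i_1}+N_{i_2},\ \dfrac{6\log\left(4N\beta^{-1}/(\Delta_i-\delta_{d_i})^2\right)}{(\Delta_i-\delta_{d_i})^2}\right), & \text{if } i\in I.\end{cases}$$ Then, with probability at least $1-\beta$, for all $n\ge1$ and all sub-optimal nodes $i$ (i.e. nodes with $\Delta_i>0$), $n_i(n)\le N_i$.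
   Context: Setting. Consider the full binary tree of depth $D\ge1$ (the root has depth $0$, the $2^D$ leaves have depth $D$, every non-leaf node has two children, and $\mathcal C(i)$ denotes the set of children of $i$). $N=2^{D+1}-1$ is the number of nodes, and $\mathcal L(i)$ is the set of leaves of the sub-tree rooted at $i$. To each leaf $i$ is assigned a random variable $X_i$ with values in $[0,1]$ and unknown law. Successive visits of leaf $i$ yield i.i.d. rewards distributed as $X_i$, and rewards of different leaves are independent. The value of a leaf is $\mu_i=\mathbb E X_i$. The value of a node $i$ is $\mu_i=\max_{j\in\mathcal L(i)}\mu_j$; $\mu^*$ is the value of the root, and $\Delta_i=\mu^*-\mu_i$ for every node $i$. Algorithm. At each round $n=1,2,\dots$ a trajectory is run from the root to a leaf: starting at the root, from the current non-leaf node $i$ move to a child $j\in\mathcal C(i)$ having the highest bound $B_{j,n_j}$ among the children of $i$ (ties broken arbitrarily), where bounds are computed from the data of the previous rounds. On reaching a leaf, the next reward sample of that leaf is received, and the number of visits of each node on the trajectory is incremented by one. A node that has not yet been visited has bound $+\infty$. $n_i=n_i(n)$ is the number of trajectories through node $i$ up to time $n$, and $X_{i,n_i}$ is the empirical mean of the $n_i$ rewards obtained by the trajectories through $i$. BAST (Bandit Algorithm for Smooth Trees) is this algorithm with the bounds $B_{i,n_i}=X_{i,n_i}+c_{n_i}$ for a leaf $i$, and, for a non-leaf node $i$ of depth $d$, $$B_{i,n_i}=\min\left\{\max_{j\in\mathcal C(i)}B_{j,n_j},\ X_{i,n_i}+\delta_d+c_{n_i}\right\},\qquad c_n=\sqrt{\frac{\log(2Nn(n+1)\beta^{-1})}{2n}}.$$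 *)

theory Defs
  imports "HOL-Probability.Probability" "HOL-Library.Sublist"
begin

section \<open>The full binary tree\<close>

text \<open>A node is the list of left/right choices leading to it from the root \<open>[]\<close>, so its depth is
  its length and the subtree rooted at \<open>i\<close> consists of the nodes having \<open>i\<close> as a prefix.\<close>

type_synonym node = "bool list"

definition nodes :: "nat \<Rightarrow> node set" where
  "nodes D = {i. length i \<le> D}"

definition num_nodes :: "nat \<Rightarrow> nat" where
  "num_nodes D = 2 ^ (D + 1) - 1"

definition leaves :: "nat \<Rightarrow> node set" where
  "leaves D = {i. length i = D}"

text \<open>Only meaningful for non-leaf nodes.\<close>

definition children :: "node \<Rightarrow> node set" where
  "children i = {i @ [False], i @ [True]}"

definition leaves_below :: "nat \<Rightarrow> node \<Rightarrow> node set" where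
  "leaves_below D i = {l \<in> leaves D. prefix i l}"

text \<open>In what follows, \<open>\<nu> l\<close> is the law of the reward of leaf \<open>l\<close>. For a leaf \<open>i\<close> the set
  \<open>leaves_below D i\<close> is \<open>{i}\<close>, so \<open>node_value\<close> is the mean of \<open>\<nu> i\<close>.\<close>

definition node_value :: "nat \<Rightarrow> (node \<Rightarrow> real measure) \<Rightarrow> node \<Rightarrow> real" where
  "node_value D \<nu> i = Max ((\<lambda>l. \<integral>x. x \<partial>\<nu> l) ` leaves_below D i)"

definition gap :: "nat \<Rightarrow> (node \<Rightarrow> real measure) \<Rightarrow> node \<Rightarrow> real" where
  "gap D \<nu> i = node_value D \<nu> [] - node_value D \<nu> i"

text \<open>The nodes \<open>p 0, \<dots>, p D\<close> form a path from the root to a leaf.\<close>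

definition root_leaf_path :: "nat \<Rightarrow> (nat \<Rightarrow> node) \<Rightarrow> bool" where
  "root_leaf_path D p \<longleftrightarrow> p 0 = [] \<and> (\<forall>d<D. p (Suc d) \<in> children (p d))"

definition smooth_along_optimal_path ::
  "nat \<Rightarrow> (node \<Rightarrow> real measure) \<Rightarrow> (nat \<Rightarrow> real) \<Rightarrow> bool" where
  "smooth_along_optimal_path D \<nu> \<delta> \<longleftrightarrow>
     (\<exists>p. root_leaf_path D p \<and>
          (\<forall>d\<le>D. node_value D \<nu> (p d) = node_value D \<nu> []) \<and>
          (\<forall>d<D. \<forall>j\<in>leaves_below D (p d). node_value D \<nu> [] - node_value D \<nu> j \<le> \<delta> d))"

section \<open>The algorithm on a fixed table of rewards\<close>

text \<open>\<open>J n\<close> is the leaf reached in round \<open>n \<ge> 1\<close> (\<open>J 0\<close> is irrelevant), and \<open>y l s\<close> is the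
  \<open>s\<close>-th reward sample of leaf \<open>l\<close>, counting from \<open>s = 0\<close>. The trajectory of round \<open>n\<close> consists of
  the prefixes of \<open>J n\<close>.\<close>

definition visits :: "(nat \<Rightarrow> node) \<Rightarrow> nat \<Rightarrow> node \<Rightarrow> nat" where
  "visits J n i = card {k \<in> {1..n}. prefix i (J k)}"

definition reward :: "(nat \<Rightarrow> node) \<Rightarrow> (node \<Rightarrow> nat \<Rightarrow> real) \<Rightarrow> nat \<Rightarrow> real" where
  "reward J y n = y (J n) (visits J (n - 1) (J n))"

definition emp_mean :: "(nat \<Rightarrow> node) \<Rightarrow> (node \<Rightarrow> nat \<Rightarrow> real) \<Rightarrow> nat \<Rightarrow> node \<Rightarrow> real" where
  "emp_mean J y n i = (\<Sum>k \<in> {k \<in> {1..n}. prefix i (J k)}. reward J y k) / real (visits J n i)"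

definition conf_width :: "nat \<Rightarrow> real \<Rightarrow> nat \<Rightarrow> real" where
  "conf_width D \<beta> n =
     sqrt (ln (2 * real (num_nodes D) * real n * (real n + 1) / \<beta>) / (2 * real n))"

function bast_bound ::
  "nat \<Rightarrow> (nat \<Rightarrow> real) \<Rightarrow> real \<Rightarrow> (nat \<Rightarrow> node) \<Rightarrow> (node \<Rightarrow> nat \<Rightarrow> real) \<Rightarrow> nat \<Rightarrow> node \<Rightarrow> ereal" where
  "bast_bound D \<delta> \<beta> J y n i =
     (if visits J n i = 0 then \<infinity>
      else if length i \<ge> D then ereal (emp_mean J y n i + conf_width D \<beta> (visits J n i))
      else min (max (bast_bound D \<delta> \<beta> J y n (i @ [False])) (bast_bound D \<delta> \<beta> J y n (i @ [True])))
               (ereal (emp_mean J y n i + \<delta> (length i) + conf_width D \<beta> (visits J n i))))"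
  by pat_completeness auto
termination
  by (relation "Wellfounded.measure (\<lambda>(D, \<delta>, \<beta>, J, y, n, i). D - length i)") auto

declare bast_bound.simps [simp del]

text \<open>Every step of every trajectory goes to a child whose bound, computed from the data of the
  previous rounds, is maximal; this leaves the choice among tied children open.\<close>

definition bast_run ::
  "nat \<Rightarrow> (nat \<Rightarrow> real) \<Rightarrow> real \<Rightarrow> (nat \<Rightarrow> node) \<Rightarrow> (node \<Rightarrow> nat \<Rightarrow> real) \<Rightarrow> bool" where
  "bast_run D \<delta> \<beta> J y \<longleftrightarrow>
     (\<forall>n\<ge>1. J n \<in> leaves D \<and>
        (\<forall>d<D. \<forall>j\<in>children (take d (J n)).
           bast_bound D \<delta> \<beta> J y (n - 1) j \<le> bast_bound D \<delta> \<beta> J y (n - 1) (take (Suc d) (J n))))"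

section \<open>The random rewards and the random run\<close>

text \<open>\<open>Y l s\<close> is the \<open>s\<close>-th reward sample of leaf \<open>l\<close>.\<close>

definition reward_model ::
  "'w measure \<Rightarrow> nat \<Rightarrow> (node \<Rightarrow> real measure) \<Rightarrow> (node \<Rightarrow> nat \<Rightarrow> 'w \<Rightarrow> real) \<Rightarrow> bool" where
  "reward_model M D \<nu> Y \<longleftrightarrow>
     prob_space M \<and>
     prob_space.indep_vars M (\<lambda>_. borel) (\<lambda>(l, s). Y l s) (leaves D \<times> UNIV) \<and>
     (\<forall>l\<in>leaves D. \<forall>s. distr M borel (Y l s) = \<nu> l) \<and>
     (\<forall>l\<in>leaves D. AE x in \<nu> l. x \<in> {0..1})"

text \<open>Ties may be broken in any way, possibly at random and depending on the past, but not by
  looking at rewards that have not been received yet: the leaf of round \<open>n\<close> is a measurable function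
  of the rewards received in rounds \<open>1, \<dots>, n - 1\<close> and of an external random element \<open>U\<close> that is
  independent of all reward samples. The earlier leaves need not be arguments of this function,
  since recursively they are themselves functions of \<open>U\<close> and the earlier rewards.\<close>

definition non_anticipating ::
  "'w measure \<Rightarrow> nat \<Rightarrow> (node \<Rightarrow> nat \<Rightarrow> 'w \<Rightarrow> real) \<Rightarrow> 'u measure \<Rightarrow> ('w \<Rightarrow> 'u) \<Rightarrow>
     (nat \<Rightarrow> 'w \<Rightarrow> node) \<Rightarrow> bool" where
  "non_anticipating M D Y S U J \<longleftrightarrow>
     U \<in> M \<rightarrow>\<^sub>M S \<and>
     prob_space.indep_set M
       (sets (vimage_algebra (space M) U S))
       (sets (vimage_algebra (space M) (\<lambda>\<omega>. \<lambda>(l, s) \<in> leaves D \<times> UNIV. Y l s \<omega>)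
                (Pi\<^sub>M (leaves D \<times> UNIV) (\<lambda>_. borel)))) \<and>
     (\<forall>n\<ge>1. \<exists>\<phi>. \<phi> \<in> S \<Otimes>\<^sub>M Pi\<^sub>M {1..<n} (\<lambda>_. borel) \<rightarrow>\<^sub>M count_space UNIV \<and>
        (\<forall>\<omega>\<in>space M. J n \<omega> =
           \<phi> (U \<omega>, \<lambda>k\<in>{1..<n}. reward (\<lambda>m. J m \<omega>) (\<lambda>l s. Y l s \<omega>) k)))"

section \<open>The bounds on the numbers of visits\<close>

definition separated_nodes ::
  "nat \<Rightarrow> (node \<Rightarrow> real measure) \<Rightarrow> (nat \<Rightarrow> real) \<Rightarrow> node set" where
  "separated_nodes D \<nu> \<delta> = {i. length i < D \<and> gap D \<nu> i > \<delta> (length i)}"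

text \<open>Only meaningful for nodes \<open>i\<close> with \<open>gap D \<nu> i > 0\<close>; then the gaps of all nodes below \<open>i\<close> are
  positive as well.\<close>

function visit_bound ::
  "nat \<Rightarrow> (node \<Rightarrow> real measure) \<Rightarrow> (nat \<Rightarrow> real) \<Rightarrow> real \<Rightarrow> node \<Rightarrow> real" where
  "visit_bound D \<nu> \<delta> \<beta> i =
     (if length i \<ge> D then
        6 * ln (4 * real (num_nodes D) / \<beta> / (gap D \<nu> i)\<^sup>2) / (gap D \<nu> i)\<^sup>2
      else if i \<notin> separated_nodes D \<nu> \<delta> then
        visit_bound D \<nu> \<delta> \<beta> (i @ [False]) + visit_bound D \<nu> \<delta> \<beta> (i @ [True])
      else
        min (visit_bound D \<nu> \<delta> \<beta> (i @ [False]) + visit_bound D \<nu> \<delta> \<beta> (i @ [True]))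
            (6 * ln (4 * real (num_nodes D) / \<beta> / (gap D \<nu> i - \<delta> (length i))\<^sup>2)
               / (gap D \<nu> i - \<delta> (length i))\<^sup>2))"
  by pat_completeness auto
termination
  by (relation "Wellfounded.measure (\<lambda>(D, \<nu>, \<delta>, \<beta>, i). D - length i)") auto

declare visit_bound.simps [simp del]

end

theory Submission
  imports Defs
begin

text \<open>If no empirical mean deviates too far (upwards for suboptimal, downwards for optimal nodes) from
  the average value of the leaves sampled below it, smoothness makes the bounds along the optimal
  path at least \<open>\<mu>\<^sup>*\<close>, and since each step maximises the bound, so are the bounds of all nodes on
  every trajectory. A suboptimal leaf or separated node that is visited again after \<open>m\<close> visits
  therefore has an (effective) gap below twice the confidence width, which caps \<open>m\<close>; the caps add up
  over children.

  The deviations are controlled by an Azuma-Hoeffding bound for the rewards received below a node,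
  stopped at its \<open>m\<close>-th visit, and a union bound over all nodes and all \<open>m\<close>. The bounds of the theorem
  are tight enough that one has to exploit that only one side is needed for each node, which saves
  a factor 2 in the logarithm of one of the two confidence widths.\<close>

section \<open>Confidence widths\<close>

text \<open>The numerical margin left at the end of \<open>log_threshold\<close>. Bounding
  \<open>exp 1\<close> below by 8/3 turns it into a comparison of explicit rationals.\<close>

lemma ln_15_ln_12_bound: "20 * ln (15::real) < 12 * ln 12 + 15 * ln 2 + 15"
proof -
  have e: "exp (1::real) \<ge> 8/3"
    using e_approx_32 unfolding abs_le_iff by simp
  have "(15::real) ^ 20 < 12 ^ 12 * 2 ^ 15 * (8/3) ^ 15"
    by (simp add: power_divide field_simps)
  also have "\<dots> \<le> 12 ^ 12 * 2 ^ 15 * exp 1 ^ 15"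
    by (intro mult_left_mono power_mono e) auto
  finally have "ln ((15::real) ^ 20) < ln (12 ^ 12 * 2 ^ 15 * exp 1 ^ 15)"
    by (subst ln_less_cancel_iff) auto
  also have "ln ((12::real) ^ 12 * 2 ^ 15 * exp 1 ^ 15) = 12 * ln 12 + 15 * ln 2 + 15"
    by (simp only: ln_mult ln_realpow ln_exp) simp
  finally show ?thesis by (simp only: ln_realpow of_nat_numeral)
qed

lemma ln_le_tangent:
  fixes x c :: real
  assumes "0 < x" "0 < c"
  shows "ln x \<le> ln c + x / c - 1"
  using ln_le_minus_one[of "x / c"] assms by (simp add: ln_div)

text \<open>In terms of \<open>y\<close> and \<open>L\<close> the claim sets \<open>4 * ln y\<close>
  against \<open>y\<close> for \<open>y > 6 * L\<close>. Tangents of the logarithm at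
  \<open>6 * L\<close> and at 15 make it linear in \<open>L\<close> and \<open>ln K\<close>, and the
  worst case is \<open>L = ln K = ln 12\<close>.\<close>

lemma log_threshold:
  fixes a K x :: real
  assumes a: "0 < a" "a \<le> 1" and K: "12 \<le> K" and x: "6 * ln (K / a\<^sup>2) / a\<^sup>2 < x"
  shows "2 * ln (K * x\<^sup>2) < (x - 1) * a\<^sup>2 + 3 * ln 2"
proof -
  define L where "L = ln (K / a\<^sup>2)"
  define y where "y = x * a\<^sup>2"
  have a2: "0 < a\<^sup>2" "a\<^sup>2 \<le> 1" using a by (auto simp: power_le_one)
  have "K \<le> K / a\<^sup>2" using a2 K by (simp add: field_simps)
  then have LK: "ln K \<le> L" "ln 12 \<le> ln K" using K a2 by (auto simp: L_def)
  have ln12: "ln 12 \<ge> (2::real)"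
  proof -
    have "exp 1 \<le> (3::real)" by (rule exp_le)
    then have "exp 1 ^ 2 \<le> (12::real)" using power_mono[of "exp 1" "3::real" 2] by simp
    then have "exp (2::real) \<le> 12" using exp_of_nat_mult[of 2 "1::real"] by simp
    then show ?thesis by (simp add: ln_ge_iff)
  qed
  have yL: "6 * L < y" using x a2 by (simp add: L_def y_def field_simps)
  have y0: "0 < y" using yL LK ln12 by linarith
  have x0: "0 < x" using y0 a2 by (simp add: y_def zero_less_mult_iff)
  have L: "L = ln K - 2 * ln a" using a K by (simp add: L_def ln_div ln_realpow)
  have eq: "2 * ln (K * x\<^sup>2) = 4 * L - 2 * ln K + 4 * ln y"
    using a K x0 by (simp add: L y_def ln_mult ln_realpow)
  \<comment> \<open>By \<open>ln12\<close>, \<open>6 * L \<ge> 4\<close>, so \<open>4 * ln y\<close>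
    grows beyond \<open>6 * L\<close> at rate at most 1.\<close>
  have "y / (6 * L) - 1 = (y - 6 * L) / (6 * L)" using LK ln12 by (simp add: field_simps)
  also have "\<dots> \<le> (y - 6 * L) / 4"
    using yL LK ln12 by (intro divide_left_mono) auto
  finally have "4 * ln y \<le> 4 * ln (6 * L) + (y - 6 * L)"
    using ln_le_tangent[of y "6 * L"] y0 LK ln12 by argo
  \<comment> \<open>The tangent point 15 is close to \<open>6 * ln 12\<close>, the least possible
    value of \<open>6 * L\<close>.\<close>
  moreover have "ln (6 * L) \<le> ln 15 + 6 * L / 15 - 1"
    using ln_le_tangent[of "6 * L" 15] LK ln12 by simp
  ultimately have "4 * L - 2 * ln K + 4 * ln y < y - 1 + 3 * ln 2"
    using ln_15_ln_12_bound LK by argo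
  moreover have "y - 1 \<le> (x - 1) * a\<^sup>2" using a2 by (simp add: y_def algebra_simps)
  ultimately show ?thesis by (simp add: eq)
qed

lemma num_nodes_ge_3: "1 \<le> D \<Longrightarrow> 3 \<le> num_nodes D"
proof -
  assume "1 \<le> D"
  then have "(2::nat) ^ 2 \<le> 2 ^ (D + 1)" by (intro power_increasing) auto
  then show ?thesis by (simp add: num_nodes_def)
qed

text \<open>With probability at least \<open>1 - \<beta> / (N * m * (m + 1))\<close> a one-sided deviation after \<open>m\<close> visits
  stays below this width. It lacks the factor 2 in the logarithm of \<open>conf_width\<close>: using
  \<open>conf_width\<close> for the deviations as well would not give the constants of \<open>visit_bound\<close>, e.g. for
  \<open>D = 1\<close>, \<open>a = 1\<close> and \<open>\<beta>\<close> close to 1 in \<open>width_threshold\<close>.\<close>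

definition dev_width :: "nat \<Rightarrow> real \<Rightarrow> nat \<Rightarrow> real" where
  "dev_width D \<beta> m = sqrt (ln (real (num_nodes D) * real m * (real m + 1) / \<beta>) / (2 * real m))"

lemma dev_width_arg:
  assumes "1 \<le> D" "0 < \<beta>" "\<beta> < 1" "1 \<le> m"
  shows "1 < real (num_nodes D) * real m * (real m + 1) / \<beta>"
proof -
  have "1 * 1 \<le> real m * (real m + 1)"
    using assms by (intro mult_mono) auto
  then have "3 * 1 \<le> real (num_nodes D) * (real m * (real m + 1))"
    using num_nodes_ge_3[OF assms(1)] by (intro mult_mono) auto
  then have "\<beta> < real (num_nodes D) * real m * (real m + 1)" using assms by (simp add: mult.assoc)
  then show ?thesis using assms by (simp add: less_divide_eq)
qed

lemma dev_width_nonneg: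
  assumes "1 \<le> D" "0 < \<beta>" "\<beta> < 1" "1 \<le> m" shows "0 \<le> dev_width D \<beta> m"
  using dev_width_arg[OF assms] by (simp add: dev_width_def)

lemma dev_width_le_conf_width:
  assumes "1 \<le> D" "0 < \<beta>" "\<beta> < 1" "1 \<le> m"
  shows "dev_width D \<beta> m \<le> conf_width D \<beta> m"
proof -
  have "ln (real (num_nodes D) * real m * (real m + 1) / \<beta>)
      \<le> ln (2 * (real (num_nodes D) * real m * (real m + 1) / \<beta>))"
    using dev_width_arg[OF assms] by (subst ln_le_cancel_iff) auto
  then show ?thesis
    unfolding dev_width_def conf_width_def
    by (intro real_sqrt_le_mono divide_right_mono) (auto simp: mult.assoc)
qed

text \<open>Here \<open>m\<close> counts the visits before a round and \<open>m + 1\<close> those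
  after it. Squaring the condition on \<open>a\<close> bounds \<open>m * a\<^sup>2\<close> by the
  sum of the two logarithms; \<open>log_threshold\<close> at \<open>x = m + 1\<close> excludes this
  once \<open>x\<close> exceeds the bound.\<close>

lemma width_threshold:
  fixes a \<beta> :: real
  assumes "1 \<le> D" "0 < \<beta>" "\<beta> < 1" and a: "0 < a" "a \<le> 1"
    and m: "m = 0 \<or> a \<le> conf_width D \<beta> m + dev_width D \<beta> m"
  shows "real m + 1 \<le> 6 * ln (4 * real (num_nodes D) / \<beta> / a\<^sup>2) / a\<^sup>2"
proof (rule ccontr)
  define K where "K = 4 * real (num_nodes D) / \<beta>"
  define x where "x = real m + 1"
  assume "\<not> ?thesis"
  then have x: "6 * ln (K / a\<^sup>2) / a\<^sup>2 < x" by (simp add: K_def x_def)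
  have N: "3 \<le> real (num_nodes D)" using num_nodes_ge_3[OF assms(1)] by simp
  have "12 * \<beta> \<le> 4 * real (num_nodes D)" using N assms by simp
  then have K: "12 \<le> K" using assms by (simp add: K_def field_simps)
  have main: "2 * ln (K * x\<^sup>2) < (x - 1) * a\<^sup>2 + 3 * ln 2"
    using log_threshold[OF a K x] .
  show False
  proof (cases "m = 0")
    case True
    \<comment> \<open>At \<open>x = 1\<close> the inequality \<open>main\<close> reads
      \<open>2 * ln K < 3 * ln 2\<close>, which \<open>K \<ge> 12\<close> refutes.\<close>
    have "ln 12 \<le> ln K" using K by simp
    moreover have "ln (12::real) = 2 * ln 2 + ln 3"
      using ln_mult[of 4 "3::real"] ln_realpow[of "2::real" 2] by simp
    moreover have "ln (3::real) > 0" "ln (2::real) > 0" by auto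
    ultimately have "3 * ln 2 \<le> 2 * ln K" by linarith
    then show False using main True by (simp add: x_def)
  next
    case False
    define Q where "Q = real (num_nodes D) * real m * (real m + 1) / \<beta>"
    have Q: "1 < Q" using dev_width_arg[of D \<beta> m] assms False by (simp add: Q_def)
    have ac: "a \<le> conf_width D \<beta> m + dev_width D \<beta> m" using m False by simp
    have "a\<^sup>2 \<le> (conf_width D \<beta> m + dev_width D \<beta> m)\<^sup>2"
      using ac a by (intro power_mono) auto
    also have "\<dots> \<le> 2 * ((conf_width D \<beta> m)\<^sup>2 + (dev_width D \<beta> m)\<^sup>2)"
      using sum_squares_bound[of "conf_width D \<beta> m" "dev_width D \<beta> m"]
      by (simp add: power2_sum)
    also have "(conf_width D \<beta> m)\<^sup>2 = ln (2 * Q) / (2 * real m)"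
    proof -
      have "2 * real (num_nodes D) * real m * (real m + 1) / \<beta> = 2 * Q" by (simp add: Q_def)
      then show ?thesis using Q by (simp add: conf_width_def)
    qed
    also have "(dev_width D \<beta> m)\<^sup>2 = ln Q / (2 * real m)"
      using Q by (simp add: dev_width_def flip: Q_def)
    finally have "a\<^sup>2 * real m \<le> ln (2 * Q) + ln Q" using False by (simp add: field_simps)
    \<comment> \<open>Only one of the two logarithms carries the factor 2; with both,
      \<open>2 * ln 2\<close> would stand in place of \<open>3 * ln 2\<close>.\<close>
    also have "\<dots> = 2 * ln (4 * Q) - 3 * ln 2"
      using Q ln_realpow[of "2::real" 2] by (simp add: ln_mult)
    also have "ln (4 * Q) \<le> ln (K * x\<^sup>2)"
    proof -
      have "4 * Q = K * (real m * x)" by (simp add: Q_def K_def x_def)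
      also have "\<dots> \<le> K * x\<^sup>2" using K by (intro mult_left_mono) (auto simp: x_def power2_eq_square)
      finally show ?thesis using Q by simp
    qed
    finally show False using main by (simp add: x_def algebra_simps)
  qed
qed

section \<open>Executions without large deviations\<close>

lemma visits_0 [simp]: "visits J 0 i = 0"
  by (simp add: visits_def)

lemma visits_Suc: "visits J (Suc n) i = visits J n i + (if prefix i (J (Suc n)) then 1 else 0)"
proof -
  have "{k \<in> {1..Suc n}. prefix i (J k)} =
      {k \<in> {1..n}. prefix i (J k)} \<union> (if prefix i (J (Suc n)) then {Suc n} else {})"
    by (auto simp: le_Suc_eq)
  then show ?thesis by (auto simp: visits_def)
qed

lemma visits_mono: "n \<le> n' \<Longrightarrow> visits J n i \<le> visits J n' i"
  unfolding visits_def by (intro card_mono) auto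

lemma visits_cong: "(\<And>k. k \<in> {1..n} \<Longrightarrow> J k = J' k) \<Longrightarrow> visits J n i = visits J' n i"
  unfolding visits_def by (intro arg_cong[of _ _ card]) auto

text \<open>A trajectory through a non-leaf node ends in a leaf, so it continues through exactly one
  child.\<close>

lemma visits_split:
  assumes "\<And>k. 1 \<le> k \<Longrightarrow> J k \<in> leaves D" "length i < D"
  shows "visits J n i = visits J n (i @ [False]) + visits J n (i @ [True])"
proof -
  have "{k \<in> {1..n}. prefix i (J k)} =
      {k \<in> {1..n}. prefix (i @ [False]) (J k)} \<union> {k \<in> {1..n}. prefix (i @ [True]) (J k)}"
  proof (intro equalityI subsetI)
    fix k assume "k \<in> {k \<in> {1..n}. prefix i (J k)}"
    then have k: "1 \<le> k" "k \<le> n" "prefix i (J k)" by auto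
    then obtain zs where zs: "J k = i @ zs" by (auto simp: prefix_def)
    have "zs \<noteq> []" using assms k(1) zs by (auto simp: leaves_def)
    then obtain b zs' where "zs = b # zs'" by (cases zs) auto
    then show "k \<in> {k \<in> {1..n}. prefix (i @ [False]) (J k)} \<union> {k \<in> {1..n}. prefix (i @ [True]) (J k)}"
      using k zs by (cases b) auto
  qed (auto simp: append_prefixD)
  moreover have "{k \<in> {1..n}. prefix (i @ [False]) (J k)} \<inter> {k \<in> {1..n}. prefix (i @ [True]) (J k)} = {}"
    by (auto simp: prefix_def)
  ultimately show ?thesis
    unfolding visits_def by (simp add: card_Un_disjoint)
qed

section \<open>Leaves and node values\<close>

lemma finite_leaves: "finite (leaves D)"
  using finite_lists_length_eq[of "UNIV :: bool set" D] by (simp add: leaves_def)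

lemma finite_leaves_below: "finite (leaves_below D i)"
  using finite_leaves by (auto simp: leaves_below_def)

lemma leaves_below_leaf: "l \<in> leaves D \<Longrightarrow> leaves_below D l = {l}"
  by (auto simp: leaves_below_def leaves_def prefix_def)

lemma leaves_below_nonempty:
  assumes "length i \<le> D" shows "leaves_below D i \<noteq> {}"
proof -
  have "i @ replicate (D - length i) False \<in> leaves_below D i"
    using assms by (auto simp: leaves_below_def leaves_def)
  then show ?thesis by blast
qed

lemma node_value_leaf: "l \<in> leaves D \<Longrightarrow> node_value D \<nu> l = (\<integral>x. x \<partial>\<nu> l)"
  by (simp add: node_value_def leaves_below_leaf)

lemma node_value_mono:
  assumes "prefix i j" "length j \<le> D" shows "node_value D \<nu> j \<le> node_value D \<nu> i"
  unfolding node_value_def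
  using assms finite_leaves_below leaves_below_nonempty
  by (intro Max_mono) (auto simp: leaves_below_def)

lemma gap_mono: "prefix i j \<Longrightarrow> length j \<le> D \<Longrightarrow> gap D \<nu> i \<le> gap D \<nu> j"
  using node_value_mono[of i j D \<nu>] by (simp add: gap_def)

text \<open>The maximum is attained at some leaf below \<open>i\<close>.\<close>

lemma node_value_in:
  assumes "\<And>l. l \<in> leaves D \<Longrightarrow> node_value D \<nu> l \<in> A" "length i \<le> D"
  shows "node_value D \<nu> i \<in> A"
proof -
  have "node_value D \<nu> i \<in> (\<lambda>l. \<integral>x. x \<partial>\<nu> l) ` leaves_below D i"
    unfolding node_value_def
    using finite_leaves_below leaves_below_nonempty assms by (intro Max_in) auto
  then obtain l where "l \<in> leaves_below D i" "node_value D \<nu> i = (\<integral>x. x \<partial>\<nu> l)" by auto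
  then show ?thesis using assms(1)[of l] by (auto simp: leaves_below_def node_value_leaf)
qed

lemma root_leaf_path_length:
  assumes "root_leaf_path D p" "d \<le> D" shows "length (p d) = d"
  using assms(2)
proof (induction d)
  case (Suc d)
  then have "p (Suc d) \<in> children (p d)" using assms(1) by (auto simp: root_leaf_path_def)
  then show ?case using Suc by (auto simp: children_def)
qed (use assms in \<open>auto simp: root_leaf_path_def\<close>)

text \<open>Each reward is centred at the mean of the leaf actually played, not at the value of
  \<open>i\<close>; this makes the sum a martingale in the number of rounds.\<close>

definition centred_sum ::
  "nat \<Rightarrow> (node \<Rightarrow> real measure) \<Rightarrow> (nat \<Rightarrow> node) \<Rightarrow> (node \<Rightarrow> nat \<Rightarrow> real) \<Rightarrow> nat \<Rightarrow> node \<Rightarrow> real" where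
  "centred_sum D \<nu> J y n i =
     (\<Sum>k \<in> {k \<in> {1..n}. prefix i (J k)}. reward J y k - node_value D \<nu> (J k))"

text \<open>The empirical mean is the average of the sampled leaf values plus the averaged centred
  sum; the first term is at least \<open>v\<close>, the second at least \<open>-c\<close>.\<close>

lemma emp_mean_ge:
  assumes "\<And>k. k \<in> {1..n} \<Longrightarrow> prefix i (J k) \<Longrightarrow> v \<le> node_value D \<nu> (J k)"
    and "- centred_sum D \<nu> J y n i \<le> real (visits J n i) * c" and "visits J n i \<noteq> 0"
  shows "v - c \<le> emp_mean J y n i"
proof -
  let ?A = "{k \<in> {1..n}. prefix i (J k)}"
  have "real (visits J n i) * v \<le> (\<Sum>k\<in>?A. node_value D \<nu> (J k))"
    unfolding visits_def using assms(1) by (intro sum_bounded_below) auto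
  also have "\<dots> = (\<Sum>k\<in>?A. reward J y k) - centred_sum D \<nu> J y n i"
    by (simp add: centred_sum_def sum_subtractf)
  finally have "real (visits J n i) * (v - c) \<le> (\<Sum>k\<in>?A. reward J y k)"
    using assms(2) by (simp add: algebra_simps)
  then show ?thesis using assms(3) by (simp add: emp_mean_def field_simps)
qed

lemma emp_mean_le:
  assumes "\<And>k. k \<in> {1..n} \<Longrightarrow> prefix i (J k) \<Longrightarrow> node_value D \<nu> (J k) \<le> v"
    and "centred_sum D \<nu> J y n i \<le> real (visits J n i) * c" and "visits J n i \<noteq> 0"
  shows "emp_mean J y n i \<le> v + c"
proof -
  let ?A = "{k \<in> {1..n}. prefix i (J k)}"
  have "(\<Sum>k\<in>?A. reward J y k) - centred_sum D \<nu> J y n i = (\<Sum>k\<in>?A. node_value D \<nu> (J k))"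
    by (simp add: centred_sum_def sum_subtractf)
  also have "\<dots> \<le> real (visits J n i) * v"
    unfolding visits_def using assms(1) by (intro sum_bounded_above) auto
  finally have "(\<Sum>k\<in>?A. reward J y k) \<le> real (visits J n i) * (v + c)"
    using assms(2) by (simp add: algebra_simps)
  then show ?thesis using assms(3) by (simp add: emp_mean_def field_simps)
qed

text \<open>The deterministic half of the proof: one sample point outside the bad event. Each node
  carries a deviation bound on one side only, chosen by whether its gap is positive.\<close>

locale bast_execution =
  fixes D :: nat and \<beta> :: real and \<delta> :: "nat \<Rightarrow> real" and \<nu> :: "node \<Rightarrow> real measure"
    and J :: "nat \<Rightarrow> node" and y :: "node \<Rightarrow> nat \<Rightarrow> real"
  assumes D: "1 \<le> D" and \<beta>: "0 < \<beta>" "\<beta> < 1"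
    and \<delta>: "\<And>d. d < D \<Longrightarrow> 0 < \<delta> d"
    and leaf_values: "\<And>l. l \<in> leaves D \<Longrightarrow> node_value D \<nu> l \<in> {0..1}"
    and smooth: "smooth_along_optimal_path D \<nu> \<delta>"
    and run: "bast_run D \<delta> \<beta> J y"
    and upper: "\<And>n i. i \<in> nodes D \<Longrightarrow> 0 < gap D \<nu> i \<Longrightarrow> visits J n i \<noteq> 0 \<Longrightarrow>
      centred_sum D \<nu> J y n i \<le> real (visits J n i) * dev_width D \<beta> (visits J n i)"
    and lower: "\<And>n i. i \<in> nodes D \<Longrightarrow> gap D \<nu> i \<le> 0 \<Longrightarrow> visits J n i \<noteq> 0 \<Longrightarrow>
      - centred_sum D \<nu> J y n i \<le> real (visits J n i) * dev_width D \<beta> (visits J n i)"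
begin

lemma J_leaf: "1 \<le> k \<Longrightarrow> J k \<in> leaves D"
  using run by (auto simp: bast_run_def)

lemma gap_le_1: "length i \<le> D \<Longrightarrow> gap D \<nu> i \<le> 1"
  using node_value_in[of D \<nu> "{0..1}" i] node_value_in[of D \<nu> "{0..1}" "[]"] leaf_values by (simp add: gap_def)

text \<open>Induction from the leaf up to the root. In the minimum defining the bound, the
  children's term is covered by the next path node; in the other term smoothness makes every sampled
  leaf at most \<open>\<delta> d\<close> worse than the optimum, and \<open>conf_width\<close>
  absorbs the deviation.\<close>

lemma optimal_bound_ge:
  assumes p: "root_leaf_path D p" "\<And>d. d \<le> D \<Longrightarrow> node_value D \<nu> (p d) = node_value D \<nu> []"
      "\<And>d j. d < D \<Longrightarrow> j \<in> leaves_below D (p d) \<Longrightarrow> node_value D \<nu> [] - node_value D \<nu> j \<le> \<delta> d"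
    and d: "d \<le> D"
  shows "ereal (node_value D \<nu> []) \<le> bast_bound D \<delta> \<beta> J y n (p d)"
  using d
proof (induction d rule: inc_induct)
  case base
  let ?m = "visits J n (p D)"
  have len: "length (p D) = D" using p(1) by (rule root_leaf_path_length) simp
  show ?case
  proof (cases "?m = 0")
    case False
    have "node_value D \<nu> [] - dev_width D \<beta> ?m \<le> emp_mean J y n (p D)"
    proof (rule emp_mean_ge[where D = D and \<nu> = \<nu>])
      fix k assume "k \<in> {1..n}" "prefix (p D) (J k)"
      \<comment> \<open>A leaf has no proper extension among the leaves, so a trajectory through
        \<open>p D\<close> ends there.\<close>
      then have "p D = J k" using J_leaf[of k] len prefix_length_less[of "p D" "J k"]
        by (force simp: leaves_def strict_prefix_def)
      then show "node_value D \<nu> [] \<le> node_value D \<nu> (J k)" using p(2)[of D] by simp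
    qed (use lower[of "p D" n] len p(2)[of D] False in \<open>auto simp: nodes_def gap_def\<close>)
    then show ?thesis
      using dev_width_le_conf_width[OF D \<beta>, of ?m] False len
      by (subst bast_bound.simps) auto
  qed (simp add: bast_bound.simps)
next
  case (step d)
  let ?m = "visits J n (p d)"
  have len: "length (p d) = d" using p(1) by (rule root_leaf_path_length) (use step in simp)
  show ?case
  proof (cases "?m = 0")
    case False
    have "node_value D \<nu> [] - \<delta> d - dev_width D \<beta> ?m \<le> emp_mean J y n (p d)"
    proof (rule emp_mean_ge[where D = D and \<nu> = \<nu>])
      fix k assume "k \<in> {1..n}" "prefix (p d) (J k)"
      then have "J k \<in> leaves_below D (p d)" using J_leaf[of k] by (auto simp: leaves_below_def)
      then show "node_value D \<nu> [] - \<delta> d \<le> node_value D \<nu> (J k)" using p(3)[of d "J k"] step by simp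
    qed (use lower[of "p d" n] len p(2)[of d] False step in \<open>auto simp: nodes_def gap_def\<close>)
    then have "node_value D \<nu> [] \<le> emp_mean J y n (p d) + \<delta> d + conf_width D \<beta> ?m"
      using dev_width_le_conf_width[OF D \<beta>, of ?m] False by simp
    moreover have "p (Suc d) \<in> {p d @ [False], p d @ [True]}"
      using p(1) step by (auto simp: root_leaf_path_def children_def)
    then have "ereal (node_value D \<nu> []) \<le>
        max (bast_bound D \<delta> \<beta> J y n (p d @ [False])) (bast_bound D \<delta> \<beta> J y n (p d @ [True]))"
      using step.IH by (auto simp: le_max_iff_disj)
    ultimately show ?thesis
      using False len step by (subst bast_bound.simps) auto
  qed (simp add: bast_bound.simps)
qed

text \<open>Induction down from the root, which lies on the optimal path. The bound of a visited
  inner node is at most the larger of its children's bounds, and the trajectory moves to a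
  maximising child.\<close>

lemma trajectory_bound_ge:
  assumes "1 \<le> n" "d \<le> D"
  shows "ereal (node_value D \<nu> []) \<le> bast_bound D \<delta> \<beta> J y (n - 1) (take d (J n))"
  using assms(2)
proof (induction d)
  case 0
  obtain p where p: "root_leaf_path D p" "\<And>d. d \<le> D \<Longrightarrow> node_value D \<nu> (p d) = node_value D \<nu> []"
      "\<And>d j. d < D \<Longrightarrow> j \<in> leaves_below D (p d) \<Longrightarrow> node_value D \<nu> [] - node_value D \<nu> j \<le> \<delta> d"
    using smooth unfolding smooth_along_optimal_path_def by metis
  then have "ereal (node_value D \<nu> []) \<le> bast_bound D \<delta> \<beta> J y (n - 1) (p 0)"
    by (intro optimal_bound_ge) auto
  then show ?case using p(1) by (simp add: root_leaf_path_def)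
next
  case (Suc d)
  let ?i = "take d (J n)"
  let ?B = "bast_bound D \<delta> \<beta> J y (n - 1)"
  have len: "length ?i = d" using J_leaf[OF assms(1)] Suc by (simp add: leaves_def)
  have max: "?B (?i @ [b]) \<le> ?B (take (Suc d) (J n))" for b
    using run assms(1) Suc by (cases b) (auto simp: bast_run_def children_def)
  have "ereal (node_value D \<nu> []) \<le> max (?B (?i @ [False])) (?B (?i @ [True]))"
  proof (cases "visits J (n - 1) ?i = 0")
    case True
    \<comment> \<open>An unvisited node has bound \<infinity> irrespective of its children, but then
      they are unvisited and have bound \<infinity> as well.\<close>
    then have "visits J (n - 1) (?i @ [False]) = 0"
      using visits_split[of J D ?i "n - 1"] J_leaf len Suc by simp
    then have "?B (?i @ [False]) = \<infinity>" by (subst bast_bound.simps) simp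
    then show ?thesis by simp
  next
    case False
    have IH: "ereal (node_value D \<nu> []) \<le> ?B ?i" using Suc by simp
    also have "?B ?i \<le> max (?B (?i @ [False])) (?B (?i @ [True]))"
      using False len Suc by (subst bast_bound.simps) simp
    finally show ?thesis .
  qed
  then show ?case using max order.trans by (meson le_max_iff_disj)
qed

text \<open>The bound of \<open>i\<close> is squeezed: at least the optimal value because round
  \<open>n\<close> passes through \<open>i\<close>, and at most the value of \<open>i\<close> plus
  the smoothness term and both widths.\<close>

lemma revisit_bound:
  assumes i: "i \<in> nodes D" "0 < gap D \<nu> i" and n: "1 \<le> n" "prefix i (J n)"
    and m: "visits J (n - 1) i \<noteq> 0"
  shows "gap D \<nu> i \<le> (if length i < D then \<delta> (length i) else 0) +
    conf_width D \<beta> (visits J (n - 1) i) + dev_width D \<beta> (visits J (n - 1) i)"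
proof -
  let ?m = "visits J (n - 1) i"
  have "take (length i) (J n) = i" using n by (auto simp: prefix_def)
  then have "ereal (node_value D \<nu> []) \<le> bast_bound D \<delta> \<beta> J y (n - 1) i"
    using trajectory_bound_ge[OF n(1), of "length i"] i by (simp add: nodes_def)
  also have "\<dots> \<le> ereal (emp_mean J y (n - 1) i +
      (if length i < D then \<delta> (length i) else 0) + conf_width D \<beta> ?m)"
    using m by (subst bast_bound.simps) auto
  also have "emp_mean J y (n - 1) i \<le> node_value D \<nu> i + dev_width D \<beta> ?m"
  proof (rule emp_mean_le[where D = D and \<nu> = \<nu>])
    fix k assume k: "k \<in> {1..n - 1}" "prefix i (J k)"
    then show "node_value D \<nu> (J k) \<le> node_value D \<nu> i"
      using J_leaf[of k] by (intro node_value_mono) (auto simp: leaves_def)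
  qed (use m upper i in auto)
  finally show ?thesis by (simp add: gap_def)
qed

text \<open>Here \<open>a\<close> is the effective gap. The count rises only in rounds through
  \<open>i\<close>, and there \<open>revisit_bound\<close> caps the count before the round, so
  \<open>width_threshold\<close> caps it after the round.\<close>

lemma visits_le_threshold:
  assumes i: "i \<in> nodes D" "0 < gap D \<nu> i"
    and a: "a = gap D \<nu> i - (if length i < D then \<delta> (length i) else 0)" "0 < a"
  shows "real (visits J n i) \<le> 6 * ln (4 * real (num_nodes D) / \<beta> / a\<^sup>2) / a\<^sup>2"
proof (induction n)
  case 0
  have "a \<le> 1"
    using gap_le_1[of i] \<delta>[of "length i"] i a by (auto simp: nodes_def split: if_splits)
  from width_threshold[OF D \<beta> a(2) this, of 0] show ?case by simp
next
  case (Suc n)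
  have "a \<le> 1"
    using gap_le_1[of i] \<delta>[of "length i"] i a by (auto simp: nodes_def split: if_splits)
  then have "real (visits J n i) + 1 \<le> 6 * ln (4 * real (num_nodes D) / \<beta> / a\<^sup>2) / a\<^sup>2"
    if "prefix i (J (Suc n))"
  proof (rule width_threshold[OF D \<beta> a(2)])
    show "visits J n i = 0 \<or> a \<le> conf_width D \<beta> (visits J n i) + dev_width D \<beta> (visits J n i)"
      using revisit_bound[OF i _ that] a(1) by fastforce
  qed
  with Suc show ?case by (simp add: visits_Suc)
qed

lemma visits_le_visit_bound:
  assumes "i \<in> nodes D" "0 < gap D \<nu> i"
  shows "real (visits J n i) \<le> visit_bound D \<nu> \<delta> \<beta> i"
  using assms
proof (induction "D - length i" arbitrary: i)
  case 0
  then show ?case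
    using visits_le_threshold[of i "gap D \<nu> i" n] by (subst visit_bound.simps) (simp add: nodes_def)
next
  case (Suc m)
  then have len: "length i < D" by simp
  \<comment> \<open>Gaps grow down the tree, so the children of a suboptimal node are suboptimal and
    the induction hypothesis applies.\<close>
  have child: "real (visits J n (i @ [b])) \<le> visit_bound D \<nu> \<delta> \<beta> (i @ [b])" for b
    using Suc len gap_mono[of i "i @ [b]" D \<nu>] by (intro Suc.hyps(1)) (auto simp: nodes_def)
  have "real (visits J n i) \<le>
      visit_bound D \<nu> \<delta> \<beta> (i @ [False]) + visit_bound D \<nu> \<delta> \<beta> (i @ [True])"
    using visits_split[of J D i n] J_leaf len child[of False] child[of True] by simp
  moreover have "real (visits J n i) \<le>
      6 * ln (4 * real (num_nodes D) / \<beta> / (gap D \<nu> i - \<delta> (length i))\<^sup>2)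
        / (gap D \<nu> i - \<delta> (length i))\<^sup>2" if "i \<in> separated_nodes D \<nu> \<delta>"
    using that visits_le_threshold[of i "gap D \<nu> i - \<delta> (length i)" n] Suc.prems len
    by (simp add: separated_nodes_def)
  ultimately show ?case using len by (subst visit_bound.simps) auto
qed

end

section \<open>Integrals of independent variables\<close>

text \<open>Turns independence of the generated sigma-algebras, as used in
  \<open>non_anticipating\<close>, into a product law. Agreement on rectangles suffices.\<close>

lemma (in prob_space) distr_pair_indep_set:
  assumes X: "X \<in> M \<rightarrow>\<^sub>M S" and Z: "Z \<in> M \<rightarrow>\<^sub>M T"
    and indep: "indep_set (sets (vimage_algebra (space M) X S)) (sets (vimage_algebra (space M) Z T))"
  shows "distr M (S \<Otimes>\<^sub>M T) (\<lambda>\<omega>. (X \<omega>, Z \<omega>)) = distr M S X \<Otimes>\<^sub>M distr M T Z"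
proof (rule pair_measure_eqI[symmetric])
  interpret X: prob_space "distr M S X" by (rule prob_space_distr[OF X])
  interpret Z: prob_space "distr M T Z" by (rule prob_space_distr[OF Z])
  show "sigma_finite_measure (distr M S X)" "sigma_finite_measure (distr M T Z)" by unfold_locales
  fix A B assume "A \<in> sets (distr M S X)" "B \<in> sets (distr M T Z)"
  then have A: "A \<in> sets S" and B: "B \<in> sets T" by auto
  have "emeasure (distr M (S \<Otimes>\<^sub>M T) (\<lambda>\<omega>. (X \<omega>, Z \<omega>))) (A \<times> B) =
      emeasure M ((X -` A \<inter> space M) \<inter> (Z -` B \<inter> space M))"
    using A B X Z by (subst emeasure_distr) (auto intro!: arg_cong[of _ _ "emeasure M"])
  also have "prob ((X -` A \<inter> space M) \<inter> (Z -` B \<inter> space M)) =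
      prob (X -` A \<inter> space M) * prob (Z -` B \<inter> space M)"
    using indep in_vimage_algebra[OF A, of X "space M"] in_vimage_algebra[OF B, of Z "space M"]
    unfolding indep_sets2_eq by simp
  then have "emeasure M ((X -` A \<inter> space M) \<inter> (Z -` B \<inter> space M)) =
      emeasure M (X -` A \<inter> space M) * emeasure M (Z -` B \<inter> space M)"
    by (simp add: emeasure_eq_measure ennreal_mult)
  finally show "emeasure (distr M S X) A * emeasure (distr M T Z) B =
      emeasure (distr M (S \<Otimes>\<^sub>M T) (\<lambda>\<omega>. (X \<omega>, Z \<omega>))) (A \<times> B)"
    using A B X Z by (simp add: emeasure_distr)
qed simp

text \<open>Freezes \<open>X\<close> at a value \<open>x\<close> while \<open>Z\<close> remains a
  random variable on \<open>M\<close>, so that facts about \<open>M\<close> stay applicable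
  inside.\<close>

lemma (in prob_space) nn_integral_pair_iterated:
  assumes [measurable]: "X \<in> M \<rightarrow>\<^sub>M S" "Z \<in> M \<rightarrow>\<^sub>M T" "f \<in> borel_measurable (S \<Otimes>\<^sub>M T)"
    and "distr M (S \<Otimes>\<^sub>M T) (\<lambda>\<omega>. (X \<omega>, Z \<omega>)) = distr M S X \<Otimes>\<^sub>M distr M T Z"
  shows "(\<integral>\<^sup>+\<omega>. f (X \<omega>, Z \<omega>) \<partial>M) = (\<integral>\<^sup>+x. \<integral>\<^sup>+\<omega>. f (x, Z \<omega>) \<partial>M \<partial>distr M S X)"
proof -
  interpret Z: prob_space "distr M T Z" by (rule prob_space_distr) simp
  have "(\<integral>\<^sup>+\<omega>. f (X \<omega>, Z \<omega>) \<partial>M) = (\<integral>\<^sup>+p. f p \<partial>distr M (S \<Otimes>\<^sub>M T) (\<lambda>\<omega>. (X \<omega>, Z \<omega>)))"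
    by (simp add: nn_integral_distr)
  also have "\<dots> = (\<integral>\<^sup>+p. f p \<partial>(distr M S X \<Otimes>\<^sub>M distr M T Z))"
    by (simp only: assms(4))
  also have "\<dots> = (\<integral>\<^sup>+x. \<integral>\<^sup>+z. f (x, z) \<partial>distr M T Z \<partial>distr M S X)"
    by (rule Z.nn_integral_fst[symmetric]) simp
  also have "\<dots> = (\<integral>\<^sup>+x. \<integral>\<^sup>+\<omega>. f (x, Z \<omega>) \<partial>M \<partial>distr M S X)"
    by (intro nn_integral_cong nn_integral_distr) auto
  finally show ?thesis .
qed

lemma (in prob_space) nn_integral_pair_mult:
  fixes f :: "'b \<Rightarrow> ennreal" and g :: "'c \<Rightarrow> ennreal"
  assumes [measurable]: "X \<in> M \<rightarrow>\<^sub>M S" "Z \<in> M \<rightarrow>\<^sub>M T" "f \<in> borel_measurable S" "g \<in> borel_measurable T"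
    and "distr M (S \<Otimes>\<^sub>M T) (\<lambda>\<omega>. (X \<omega>, Z \<omega>)) = distr M S X \<Otimes>\<^sub>M distr M T Z"
  shows "(\<integral>\<^sup>+\<omega>. f (X \<omega>) * g (Z \<omega>) \<partial>M) = (\<integral>\<^sup>+\<omega>. f (X \<omega>) \<partial>M) * (\<integral>\<^sup>+\<omega>. g (Z \<omega>) \<partial>M)"
proof -
  have "(\<integral>\<^sup>+\<omega>. f (X \<omega>) * g (Z \<omega>) \<partial>M) = (\<integral>\<^sup>+x. \<integral>\<^sup>+\<omega>. f x * g (Z \<omega>) \<partial>M \<partial>distr M S X)"
    using nn_integral_pair_iterated[of X S Z T "\<lambda>(x, z). f x * g z"] assms(5) by simp
  then show ?thesis
    by (simp add: nn_integral_cmult nn_integral_multc nn_integral_distr)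
qed

text \<open>Both signs of \<open>t\<close> are wanted, for upper and lower deviations; negative
  \<open>t\<close> is reduced to positive by passing to \<open>- X\<close>. The compensator
  \<open>t\<^sup>2 / 8\<close> sits in the exponent to give one factor of the
  supermartingale.\<close>

lemma (in prob_space) Hoeffdings_lemma_unit_interval:
  assumes X: "X \<in> borel_measurable M" and "AE x in M. X x \<in> {0..1}"
  shows "(\<integral>\<^sup>+x. ennreal (exp (t * (X x - expectation X) - t\<^sup>2 / 8)) \<partial>M) \<le> 1"
proof -
  have "(\<integral>\<^sup>+x. ennreal (exp (t * (X x - expectation X))) \<partial>M) \<le> ennreal (exp (t\<^sup>2 / 8))"
  proof -
    consider "t = 0" | "t > 0" | "t < 0" by linarith
    then show ?thesis
    proof cases
      case 1
      then show ?thesis by (simp add: emeasure_space_1)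
    next
      case 2
      interpret interval_bounded_random_variable M X 0 1
        by unfold_locales (use assms in auto)
      show ?thesis using Hoeffdings_lemma_nn_integral[OF 2] by simp
    next
      case 3
      interpret interval_bounded_random_variable M "\<lambda>x. - X x" "-1" 0
        by unfold_locales (use assms in auto)
      show ?thesis using Hoeffdings_lemma_nn_integral[of "- t"] 3 by (simp add: algebra_simps)
    qed
  qed
  then have "(\<integral>\<^sup>+x. ennreal (exp (t * (X x - expectation X))) \<partial>M) * ennreal (exp (- (t\<^sup>2 / 8))) \<le>
      ennreal (exp (t\<^sup>2 / 8)) * ennreal (exp (- (t\<^sup>2 / 8)))"
    by (intro mult_right_mono) auto
  also have "\<dots> = 1" by (simp flip: ennreal_mult exp_add)
  also have "(\<integral>\<^sup>+x. ennreal (exp (t * (X x - expectation X))) \<partial>M) * ennreal (exp (- (t\<^sup>2 / 8))) =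
      (\<integral>\<^sup>+x. ennreal (exp (t * (X x - expectation X) - t\<^sup>2 / 8)) \<partial>M)"
    using X by (simp flip: nn_integral_multc ennreal_mult exp_add)
  finally show ?thesis .
qed

section \<open>The received rewards\<close>

text \<open>The entry of the reward table that is read in round \<open>k\<close>. It is determined
  by the leaves up to round \<open>k\<close>, so it is a fixed index once the history is
  fixed.\<close>

definition slot :: "(nat \<Rightarrow> node) \<Rightarrow> nat \<Rightarrow> node \<times> nat" where
  "slot h k = (h k, visits h (k - 1) (h k))"

lemma reward_slot: "reward h y k = case_prod y (slot h k)"
  by (simp add: reward_def slot_def)

lemma slot_cong: "1 \<le> k \<Longrightarrow> (\<And>j. j \<in> {1..k} \<Longrightarrow> h j = h' j) \<Longrightarrow> slot h k = slot h' k"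
  using visits_cong[of "k - 1" h h' "h' k"] by (force simp: slot_def)

text \<open>No entry is read twice, because reading one raises the visit count of its leaf. This is
  what makes the last reward fresh.\<close>

lemma slot_distinct:
  assumes "1 \<le> j" "j < k" shows "slot h j \<noteq> slot h k"
proof
  assume eq: "slot h j = slot h k"
  then have hj: "h j = h k" by (simp add: slot_def)
  have "visits h (j - 1) (h k) < visits h j (h k)"
    using visits_Suc[of h "j - 1" "h k"] assms hj by simp
  also have "\<dots> \<le> visits h (k - 1) (h k)" using assms by (intro visits_mono) simp
  finally show False using eq hj by (simp add: slot_def)
qed

text \<open>The probabilistic half of the proof, set up for any non-anticipating choice of
  leaves.\<close>

locale bandit = prob_space M for M :: "'w measure" +
  fixes D :: nat and \<nu> :: "node \<Rightarrow> real measure" and Y :: "node \<Rightarrow> nat \<Rightarrow> 'w \<Rightarrow> real"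
    and S :: "'u measure" and U :: "'w \<Rightarrow> 'u" and J :: "nat \<Rightarrow> 'w \<Rightarrow> node"
  assumes model: "reward_model M D \<nu> Y"
    and non_anticipating: "non_anticipating M D Y S U J"
    and J_leaf: "\<And>n \<omega>. 1 \<le> n \<Longrightarrow> \<omega> \<in> space M \<Longrightarrow> J n \<omega> \<in> leaves D"
begin

abbreviation slots :: "(node \<times> nat) set" where
  "slots \<equiv> leaves D \<times> UNIV"

abbreviation sample :: "'w \<Rightarrow> node \<times> nat \<Rightarrow> real" where
  "sample \<omega> a \<equiv> Y (fst a) (snd a) \<omega>"

abbreviation played :: "'w \<Rightarrow> nat \<Rightarrow> node" where
  "played \<omega> \<equiv> \<lambda>n. J n \<omega>"

abbreviation received :: "'w \<Rightarrow> nat \<Rightarrow> real" where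
  "received \<omega> \<equiv> reward (played \<omega>) (\<lambda>l s. Y l s \<omega>)"

text \<open>Extensional functions, so that there are finitely many and each sample point has exactly
  one history.\<close>

definition histories :: "nat \<Rightarrow> (nat \<Rightarrow> node) set" where
  "histories n = {1..n} \<rightarrow>\<^sub>E leaves D"

definition history_event :: "nat \<Rightarrow> (nat \<Rightarrow> node) \<Rightarrow> 'w set" where
  "history_event n h = {\<omega> \<in> space M. \<forall>k\<in>{1..n}. J k \<omega> = h k}"

lemma received_slot: "received \<omega> k = sample \<omega> (slot (played \<omega>) k)"
  by (simp add: reward_slot case_prod_beta)

lemma indep_samples: "indep_vars (\<lambda>_. borel) (\<lambda>a \<omega>. sample \<omega> a) slots"
  using model by (simp add: reward_model_def case_prod_beta')

lemma U_measurable [measurable]: "U \<in> M \<rightarrow>\<^sub>M S"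
  using non_anticipating by (simp add: non_anticipating_def)

lemma sample_measurable: "a \<in> slots \<Longrightarrow> (\<lambda>\<omega>. sample \<omega> a) \<in> borel_measurable M"
  using indep_samples by (auto simp: indep_vars_def)

lemma samples_measurable [measurable]:
  "K \<subseteq> slots \<Longrightarrow> (\<lambda>\<omega>. restrict (sample \<omega>) K) \<in> M \<rightarrow>\<^sub>M Pi\<^sub>M K (\<lambda>_. borel)"
  by (intro measurable_restrict sample_measurable) auto

lemma distr_U_samples:
  "distr M (S \<Otimes>\<^sub>M Pi\<^sub>M slots (\<lambda>_. borel)) (\<lambda>\<omega>. (U \<omega>, restrict (sample \<omega>) slots)) =
    distr M S U \<Otimes>\<^sub>M distr M (Pi\<^sub>M slots (\<lambda>_. borel)) (\<lambda>\<omega>. restrict (sample \<omega>) slots)"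
proof (rule distr_pair_indep_set)
  have "(\<lambda>\<omega>. \<lambda>(l, s)\<in>slots. Y l s \<omega>) = (\<lambda>\<omega>. restrict (sample \<omega>) slots)"
    by (simp add: case_prod_beta')
  then show "indep_set (sets (vimage_algebra (space M) U S))
      (sets (vimage_algebra (space M) (\<lambda>\<omega>. restrict (sample \<omega>) slots) (Pi\<^sub>M slots (\<lambda>_. borel))))"
    using non_anticipating by (simp add: non_anticipating_def)
qed (use samples_measurable[OF subset_refl] in auto)

text \<open>As \<open>U\<close> is independent of all samples, it can be frozen at \<open>u\<close>.
  For fixed \<open>u\<close> the sample at \<open>a\<close> is independent of the others and its
  integral splits off as a constant; then \<open>u\<close> is integrated out again.\<close>

lemma nn_integral_fresh_sample:
  assumes a: "a \<in> slots"
    and F [measurable]: "F \<in> borel_measurable (S \<Otimes>\<^sub>M Pi\<^sub>M (slots - {a}) (\<lambda>_. borel))"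
    and g [measurable]: "g \<in> borel_measurable borel"
  shows "(\<integral>\<^sup>+\<omega>. F (U \<omega>, restrict (sample \<omega>) (slots - {a})) * g (sample \<omega> a) \<partial>M) =
    (\<integral>\<^sup>+\<omega>. F (U \<omega>, restrict (sample \<omega>) (slots - {a})) \<partial>M) * (\<integral>\<^sup>+\<omega>. g (sample \<omega> a) \<partial>M)"
    (is "?lhs = ?rhs")
proof -
  let ?B = "slots - {a}"
  have [measurable]: "(\<lambda>y. restrict y ?B) \<in> Pi\<^sub>M slots (\<lambda>_. borel) \<rightarrow>\<^sub>M Pi\<^sub>M ?B (\<lambda>_. borel)"
    by (rule measurable_restrict_subset) auto
  have [measurable]: "(\<lambda>y. y a) \<in> Pi\<^sub>M slots (\<lambda>_. borel) \<rightarrow>\<^sub>M borel"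
    by (rule measurable_component_singleton) (rule a)
  have [measurable]: "(\<lambda>y. y a) \<in> Pi\<^sub>M {a} (\<lambda>_. borel) \<rightarrow>\<^sub>M borel"
    by (rule measurable_component_singleton) simp
  have [measurable]: "(\<lambda>\<omega>. restrict (sample \<omega>) slots) \<in> M \<rightarrow>\<^sub>M Pi\<^sub>M slots (\<lambda>_. borel)"
      "(\<lambda>\<omega>. restrict (sample \<omega>) {a}) \<in> M \<rightarrow>\<^sub>M Pi\<^sub>M {a} (\<lambda>_. borel)"
      "(\<lambda>\<omega>. restrict (sample \<omega>) ?B) \<in> M \<rightarrow>\<^sub>M Pi\<^sub>M ?B (\<lambda>_. borel)"
    using a by (auto intro!: samples_measurable)
  have [measurable]: "(\<lambda>\<omega>. sample \<omega> a) \<in> borel_measurable M"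
    using a by (rule sample_measurable)
  have restr: "slots \<inter> ?B = ?B" "restrict (sample \<omega>) slots a = sample \<omega> a" for \<omega>
    using a by auto
  have "indep_var (Pi\<^sub>M ?B (\<lambda>_. borel)) (\<lambda>\<omega>. restrict (sample \<omega>) ?B)
      (Pi\<^sub>M {a} (\<lambda>_. borel)) (\<lambda>\<omega>. restrict (sample \<omega>) {a})"
    using a by (intro indep_var_restrict[OF indep_samples]) auto
  then have indep: "(\<integral>\<^sup>+\<omega>. F (u, restrict (sample \<omega>) ?B) * g (sample \<omega> a) \<partial>M) =
      (\<integral>\<^sup>+\<omega>. F (u, restrict (sample \<omega>) ?B) \<partial>M) * (\<integral>\<^sup>+\<omega>. g (sample \<omega> a) \<partial>M)"
    if [measurable]: "u \<in> space S" for u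
    using nn_integral_pair_mult[of "\<lambda>\<omega>. restrict (sample \<omega>) ?B" "Pi\<^sub>M ?B (\<lambda>_. borel)"
      "\<lambda>\<omega>. restrict (sample \<omega>) {a}" "Pi\<^sub>M {a} (\<lambda>_. borel)" "\<lambda>y. F (u, y)" "\<lambda>y. g (y a)"]
    by (simp add: indep_var_distribution_eq)
  have "?lhs = (\<integral>\<^sup>+u. \<integral>\<^sup>+\<omega>. F (u, restrict (sample \<omega>) ?B) * g (sample \<omega> a) \<partial>M \<partial>distr M S U)"
    using nn_integral_pair_iterated[OF U_measurable _ _ distr_U_samples,
      of "\<lambda>(u, y). F (u, restrict y ?B) * g (y a)"] by (simp add: restr del: restrict_apply)
  also have "\<dots> = (\<integral>\<^sup>+u. (\<integral>\<^sup>+\<omega>. F (u, restrict (sample \<omega>) ?B) \<partial>M) * (\<integral>\<^sup>+\<omega>. g (sample \<omega> a) \<partial>M)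
      \<partial>distr M S U)"
    by (intro nn_integral_cong indep) simp
  also have "\<dots> = (\<integral>\<^sup>+u. (\<integral>\<^sup>+\<omega>. F (u, restrict (sample \<omega>) ?B) \<partial>M) \<partial>distr M S U) *
      (\<integral>\<^sup>+\<omega>. g (sample \<omega> a) \<partial>M)"
    by (intro nn_integral_multc) measurable
  also have "(\<integral>\<^sup>+u. (\<integral>\<^sup>+\<omega>. F (u, restrict (sample \<omega>) ?B) \<partial>M) \<partial>distr M S U) =
      (\<integral>\<^sup>+\<omega>. F (U \<omega>, restrict (sample \<omega>) ?B) \<partial>M)"
    using nn_integral_pair_iterated[OF U_measurable _ _ distr_U_samples,
      of "\<lambda>(u, y). F (u, restrict y ?B)"] by (simp add: restr del: restrict_apply)
  finally show ?thesis .
qed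

lemma sample_law:
  assumes "a \<in> slots"
  shows "expectation (\<lambda>\<omega>. sample \<omega> a) = node_value D \<nu> (fst a)"
    and "AE \<omega> in M. sample \<omega> a \<in> {0..1}"
proof -
  have \<nu>: "distr M borel (\<lambda>\<omega>. sample \<omega> a) = \<nu> (fst a)" "AE x in \<nu> (fst a). x \<in> {0..1}"
    using model assms by (auto simp: reward_model_def)
  note [measurable] = sample_measurable[OF assms]
  show "expectation (\<lambda>\<omega>. sample \<omega> a) = node_value D \<nu> (fst a)"
    using assms by (subst node_value_leaf) (auto simp flip: \<nu>(1) simp: integral_distr)
  show "AE \<omega> in M. sample \<omega> a \<in> {0..1}"
    using \<nu>(2) unfolding \<nu>(1)[symmetric] by (subst (asm) AE_distr_iff) auto
qed

lemma node_value_leaf_in: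
  assumes "l \<in> leaves D" shows "node_value D \<nu> l \<in> {0..1}"
proof -
  have a: "(l, 0) \<in> slots" using assms by simp
  have X: "Y l 0 \<in> borel_measurable M" and I: "AE \<omega> in M. Y l 0 \<omega> \<in> {0..1}"
    and E: "expectation (Y l 0) = node_value D \<nu> l"
    using sample_measurable[OF a] sample_law[OF a] by simp_all
  interpret interval_bounded_random_variable M "Y l 0" 0 1
    using X I by unfold_locales
  have "0 \<le> expectation (Y l 0)"
    using I by (intro integral_ge_const integrable) (auto elim: eventually_mono)
  moreover have "expectation (Y l 0) \<le> 1"
    using I by (intro integral_le_const integrable) (auto elim: eventually_mono)
  ultimately show ?thesis using E by simp
qed

end

section \<open>The exponential supermartingale\<close>

text \<open>The rounds entering the product are selected by \<open>C\<close>, later the rounds up to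
  the \<open>m\<close>-th visit of a node; other rounds contribute 1. Selection in round
  \<open>k\<close> may depend on the leaf of that round but not on its reward.\<close>

definition exp_process ::
  "(node \<Rightarrow> real) \<Rightarrow> (nat \<Rightarrow> (nat \<Rightarrow> node) \<Rightarrow> bool) \<Rightarrow> real \<Rightarrow> nat \<Rightarrow> (nat \<Rightarrow> node) \<Rightarrow> (nat \<Rightarrow> real) \<Rightarrow> real"
  where "exp_process \<mu> C t n h r =
    (\<Prod>k\<in>{1..n}. if C k h then exp (t * (r k - \<mu> (h k)) - t\<^sup>2 / 8) else 1)"

lemma exp_process_nonneg: "0 \<le> exp_process \<mu> C t n h r"
  unfolding exp_process_def by (intro prod_nonneg) auto

lemma exp_process_Suc:
  "exp_process \<mu> C t (Suc n) h r = exp_process \<mu> C t n h r *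
    (if C (Suc n) h then exp (t * (r (Suc n) - \<mu> (h (Suc n))) - t\<^sup>2 / 8) else 1)"
  by (simp add: exp_process_def prod.nat_ivl_Suc' mult.commute)

lemma exp_process_eq:
  "exp_process \<mu> C t n h r =
    exp (t * (\<Sum>k\<in>{k \<in> {1..n}. C k h}. r k - \<mu> (h k)) - t\<^sup>2 / 8 * card {k \<in> {1..n}. C k h})"
proof -
  have "exp_process \<mu> C t n h r = (\<Prod>k\<in>{k \<in> {1..n}. C k h}. exp (t * (r k - \<mu> (h k)) - t\<^sup>2 / 8))"
    unfolding exp_process_def by (subst prod.inter_filter) auto
  then show ?thesis
    by (simp add: exp_sum[symmetric] sum_subtractf sum_distrib_left right_diff_distrib)
qed

lemma exp_process_cong:
  assumes "\<And>k h h'. 1 \<le> k \<Longrightarrow> (\<And>j. j \<in> {1..k} \<Longrightarrow> h j = h' j) \<Longrightarrow> C k h = C k h'"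
    and "\<And>k. k \<in> {1..n} \<Longrightarrow> h k = h' k" "\<And>k. k \<in> {1..n} \<Longrightarrow> r k = r' k"
  shows "exp_process \<mu> C t n h r = exp_process \<mu> C t n h' r'"
  unfolding exp_process_def
proof (intro prod.cong refl)
  fix k assume k: "k \<in> {1..n}"
  then have "C k h = C k h'" by (intro assms(1)) (use assms(2) in auto)
  then show "(if C k h then exp (t * (r k - \<mu> (h k)) - t\<^sup>2 / 8) else 1) =
      (if C k h' then exp (t * (r' k - \<mu> (h' k)) - t\<^sup>2 / 8) else 1)"
    using assms(2,3)[OF k] by simp
qed

context bandit
begin

section \<open>Splitting the sample space by histories\<close>

lemma finite_histories: "finite (histories n)"
  unfolding histories_def by (intro finite_PiE finite_leaves) auto

lemma ex1_history:
  assumes "\<omega> \<in> space M"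
  shows "\<exists>!h. h \<in> histories n \<and> \<omega> \<in> history_event n h"
proof (rule ex1I[of _ "restrict (played \<omega>) {1..n}"])
  fix h assume "h \<in> histories n \<and> \<omega> \<in> history_event n h"
  then show "h = restrict (played \<omega>) {1..n}"
    by (intro ext) (auto simp: histories_def history_event_def restrict_def PiE_def extensional_def)
next
  show "restrict (played \<omega>) {1..n} \<in> histories n \<and> \<omega> \<in> history_event n (restrict (played \<omega>) {1..n})"
    using assms J_leaf by (simp add: histories_def history_event_def)
qed

lemma sum_histories:
  assumes "\<omega> \<in> space M"
  shows "(\<Sum>h\<in>histories n. indicator (history_event n h) \<omega> * f) = (f :: ennreal)"
proof -
  obtain h where h: "h \<in> histories n" "\<omega> \<in> history_event n h"
      and uniq: "\<And>h'. h' \<in> histories n \<Longrightarrow> \<omega> \<in> history_event n h' \<Longrightarrow> h' = h"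
    using ex1_history[OF assms] by metis
  have "(\<Sum>h'\<in>histories n. indicator (history_event n h') \<omega> * f) =
      (\<Sum>h'\<in>{h}. indicator (history_event n h') \<omega> * f)"
  proof (intro sum.mono_neutral_right finite_histories ballI)
    fix h' assume "h' \<in> histories n - {h}"
    then have "\<omega> \<notin> history_event n h'" using uniq by blast
    then show "indicator (history_event n h') \<omega> * f = 0" by simp
  qed (use h in simp)
  then show ?thesis using h by simp
qed

lemma received_history:
  assumes "\<omega> \<in> history_event n h" "1 \<le> k" "k \<le> n"
  shows "received \<omega> k = sample \<omega> (slot h k)"
  using assms slot_cong[of k "played \<omega>" h] by (simp add: received_slot history_event_def)

definition policy :: "nat \<Rightarrow> 'u \<times> (nat \<Rightarrow> real) \<Rightarrow> node" where
  "policy n = (SOME \<phi>. \<phi> \<in> S \<Otimes>\<^sub>M Pi\<^sub>M {1..<n} (\<lambda>_. borel) \<rightarrow>\<^sub>M count_space UNIV \<and>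
     (\<forall>\<omega>\<in>space M. J n \<omega> = \<phi> (U \<omega>, restrict (received \<omega>) {1..<n})))"

lemma policy:
  assumes "1 \<le> n"
  shows policy_measurable: "policy n \<in> S \<Otimes>\<^sub>M Pi\<^sub>M {1..<n} (\<lambda>_. borel) \<rightarrow>\<^sub>M count_space UNIV"
    and J_policy: "\<And>\<omega>. \<omega> \<in> space M \<Longrightarrow> J n \<omega> = policy n (U \<omega>, restrict (received \<omega>) {1..<n})"
proof -
  have "\<exists>\<phi>. \<phi> \<in> S \<Otimes>\<^sub>M Pi\<^sub>M {1..<n} (\<lambda>_. borel) \<rightarrow>\<^sub>M count_space UNIV \<and>
     (\<forall>\<omega>\<in>space M. J n \<omega> = \<phi> (U \<omega>, restrict (received \<omega>) {1..<n}))"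
    using non_anticipating assms by (simp add: non_anticipating_def)
  from someI_ex[OF this] show "policy n \<in> S \<Otimes>\<^sub>M Pi\<^sub>M {1..<n} (\<lambda>_. borel) \<rightarrow>\<^sub>M count_space UNIV"
    "\<And>\<omega>. \<omega> \<in> space M \<Longrightarrow> J n \<omega> = policy n (U \<omega>, restrict (received \<omega>) {1..<n})"
    unfolding policy_def by blast+
qed

text \<open>Replays the policies on \<open>u\<close> and a table \<open>y\<close>, reading past
  rewards at the slots of \<open>h\<close>. Only slots of rounds before \<open>n\<close> are read,
  so the history event of length \<open>n\<close> is decided without the reward of round
  \<open>n\<close>.\<close>

definition consistent :: "nat \<Rightarrow> (nat \<Rightarrow> node) \<Rightarrow> 'u \<times> (node \<times> nat \<Rightarrow> real) \<Rightarrow> bool" where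
  "consistent n h = (\<lambda>(u, y). \<forall>k\<in>{1..n}. policy k (u, \<lambda>j\<in>{1..<k}. y (slot h j)) = h k)"

text \<open>As long as the first \<open>m\<close> leaves agree with \<open>h\<close>, the received
  rewards are the entries at the slots of \<open>h\<close>, so the policy of round
  \<open>m + 1\<close> gets the same input in both descriptions.\<close>

lemma history_event_iff:
  assumes "\<omega> \<in> space M" and y: "\<And>j. 1 \<le> j \<Longrightarrow> j < n \<Longrightarrow> y (slot h j) = sample \<omega> (slot h j)"
  shows "\<omega> \<in> history_event n h \<longleftrightarrow> consistent n h (U \<omega>, y)"
proof -
  define P where "P k = policy k (U \<omega>, \<lambda>j\<in>{1..<k}. y (slot h j))" for k
  have step: "J (Suc m) \<omega> = P (Suc m)" if "Suc m \<le> n" "\<forall>k\<in>{1..m}. J k \<omega> = h k" for m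
  proof -
    have "received \<omega> j = y (slot h j)" if "j \<in> {1..<Suc m}" for j
      using received_history[of \<omega> m h j] \<open>\<forall>k\<in>{1..m}. J k \<omega> = h k\<close> y[of j] assms(1) that \<open>Suc m \<le> n\<close>
      by (simp add: history_event_def)
    then have "restrict (received \<omega>) {1..<Suc m} = (\<lambda>j\<in>{1..<Suc m}. y (slot h j))"
      by (intro restrict_ext) auto
    then show ?thesis using J_policy[of "Suc m" \<omega>] assms(1) by (simp add: P_def)
  qed
  have "(\<forall>k\<in>{1..m}. J k \<omega> = h k) \<longleftrightarrow> (\<forall>k\<in>{1..m}. P k = h k)" if "m \<le> n" for m
    using that
  proof (induction m)
    case (Suc m)
    then show ?case using step[of m] by (auto simp: atLeastAtMostSuc_conv)
  qed simp
  from this[of n] show ?thesis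
    using assms(1) by (simp add: history_event_def consistent_def P_def)
qed

lemma consistent_measurable:
  assumes "\<And>j. 1 \<le> j \<Longrightarrow> j < n \<Longrightarrow> slot h j \<in> K"
  shows "Measurable.pred (S \<Otimes>\<^sub>M Pi\<^sub>M K (\<lambda>_. borel)) (consistent n h)"
proof -
  have "Measurable.pred (S \<Otimes>\<^sub>M Pi\<^sub>M K (\<lambda>_. borel))
      (\<lambda>p. policy k (fst p, \<lambda>j\<in>{1..<k}. snd p (slot h j)) = h k)" if k: "k \<in> {1..n}" for k
  proof -
    have "(\<lambda>p. \<lambda>j\<in>{1..<k}. snd p (slot h j)) \<in> S \<Otimes>\<^sub>M Pi\<^sub>M K (\<lambda>_. borel) \<rightarrow>\<^sub>M Pi\<^sub>M {1..<k} (\<lambda>_. borel)"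
    proof (rule measurable_restrict)
      fix j assume "j \<in> {1..<k}"
      then have "slot h j \<in> K" using assms k by simp
      then show "(\<lambda>p. snd p (slot h j)) \<in> S \<Otimes>\<^sub>M Pi\<^sub>M K (\<lambda>_. borel) \<rightarrow>\<^sub>M borel"
        by (intro measurable_compose[OF measurable_snd measurable_component_singleton])
    qed
    then have "(\<lambda>p. policy k (fst p, \<lambda>j\<in>{1..<k}. snd p (slot h j))) \<in>
        S \<Otimes>\<^sub>M Pi\<^sub>M K (\<lambda>_. borel) \<rightarrow>\<^sub>M count_space UNIV"
      using k by (intro measurable_compose[OF _ policy_measurable[of k]] measurable_Pair) auto
    then show ?thesis by (rule pred_eq_const1) simp
  qed
  then have "Measurable.pred (S \<Otimes>\<^sub>M Pi\<^sub>M K (\<lambda>_. borel))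
      (\<lambda>p. \<forall>k\<in>{1..n}. policy k (fst p, \<lambda>j\<in>{1..<k}. snd p (slot h j)) = h k)"
    by (intro pred_intros_finite) auto
  then show ?thesis by (simp add: consistent_def case_prod_beta')
qed

lemma slot_in_slots: "h \<in> histories n \<Longrightarrow> 1 \<le> k \<Longrightarrow> k \<le> n \<Longrightarrow> slot h k \<in> slots"
  by (auto simp: slot_def histories_def PiE_iff)

lemma history_event_sets:
  assumes "h \<in> histories n" shows "history_event n h \<in> sets M"
proof -
  have "Measurable.pred (S \<Otimes>\<^sub>M Pi\<^sub>M slots (\<lambda>_. borel)) (consistent n h)"
    using slot_in_slots[OF assms] by (intro consistent_measurable) auto
  then have "Measurable.pred M (\<lambda>\<omega>. consistent n h (U \<omega>, restrict (sample \<omega>) slots))"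
    by (rule measurable_compose[rotated]) (intro measurable_Pair U_measurable measurable_restrict sample_measurable)
  moreover have "history_event n h = {\<omega> \<in> space M. consistent n h (U \<omega>, restrict (sample \<omega>) slots)}"
    using history_event_iff[of _ n "restrict (sample _) slots" h] slot_in_slots[OF assms]
    by (auto simp: history_event_def[of n h])
  ultimately show ?thesis by simp
qed

text \<open>The history events form a finite measurable partition, and measurability can be checked
  on each piece.\<close>

lemma measurable_by_history:
  assumes g: "\<And>h. h \<in> histories n \<Longrightarrow> g h \<in> M \<rightarrow>\<^sub>M N"
    and f: "\<And>h \<omega>. h \<in> histories n \<Longrightarrow> \<omega> \<in> history_event n h \<Longrightarrow> f \<omega> = g h \<omega>"
  shows "f \<in> M \<rightarrow>\<^sub>M N"
proof (rule measurableI)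
  fix \<omega> assume \<omega>: "\<omega> \<in> space M"
  then obtain h where h: "h \<in> histories n" "\<omega> \<in> history_event n h" using ex1_history by metis
  then show "f \<omega> \<in> space N" using f g \<omega> measurable_space[OF g] by metis
next
  fix A assume A: "A \<in> sets N"
  have "f -` A \<inter> space M = (\<Union>h\<in>histories n. history_event n h \<inter> (g h -` A \<inter> space M))"
  proof (intro equalityI subsetI)
    fix \<omega> assume \<omega>: "\<omega> \<in> f -` A \<inter> space M"
    then obtain h where h: "h \<in> histories n" "\<omega> \<in> history_event n h" using ex1_history by (metis IntD2)
    then show "\<omega> \<in> (\<Union>h\<in>histories n. history_event n h \<inter> (g h -` A \<inter> space M))"
      using \<omega> f by auto
  qed (use f in \<open>auto simp: history_event_def\<close>)
  also have "\<dots> \<in> sets M"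
    using history_event_sets measurable_sets[OF g A] finite_histories by (intro sets.finite_UN) auto
  finally show "f -` A \<inter> space M \<in> sets M" .
qed

lemma visits_measurable: "(\<lambda>\<omega>. visits (played \<omega>) n i) \<in> M \<rightarrow>\<^sub>M count_space UNIV"
proof (rule measurable_by_history[where n = n and g = "\<lambda>h _. visits h n i"])
  fix h \<omega> assume "\<omega> \<in> history_event n h"
  then show "visits (played \<omega>) n i = visits h n i"
    by (intro visits_cong) (auto simp: history_event_def)
qed simp

lemma weighted_sum_measurable:
  assumes C: "\<And>k h h'. 1 \<le> k \<Longrightarrow> (\<And>j. j \<in> {1..k} \<Longrightarrow> h j = h' j) \<Longrightarrow> C k h = C k h'"
  shows "(\<lambda>\<omega>. \<Sum>k\<in>{k \<in> {1..n}. C k (played \<omega>)}. received \<omega> k - \<mu> (J k \<omega>)) \<in> borel_measurable M"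
proof (rule measurable_by_history[where n = n and
      g = "\<lambda>h \<omega>. \<Sum>k\<in>{k \<in> {1..n}. C k h}. sample \<omega> (slot h k) - \<mu> (h k)"])
  fix h \<omega> assume \<omega>: "\<omega> \<in> history_event n h"
  have "C k (played \<omega>) = C k h" if "k \<in> {1..n}" for k
    using that \<omega> by (intro C) (auto simp: history_event_def)
  then have "{k \<in> {1..n}. C k (played \<omega>)} = {k \<in> {1..n}. C k h}" by auto
  then show "(\<Sum>k\<in>{k \<in> {1..n}. C k (played \<omega>)}. received \<omega> k - \<mu> (J k \<omega>)) =
      (\<Sum>k\<in>{k \<in> {1..n}. C k h}. sample \<omega> (slot h k) - \<mu> (h k))"
    using received_history[OF \<omega>] \<omega> by (intro sum.cong) (auto simp: history_event_def)
next
  fix h assume "h \<in> histories n"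
  then have "(\<lambda>\<omega>. sample \<omega> (slot h k)) \<in> borel_measurable M" if "k \<in> {1..n}" for k
    using that by (intro sample_measurable slot_in_slots) auto
  then show "(\<lambda>\<omega>. \<Sum>k\<in>{k \<in> {1..n}. C k h}. sample \<omega> (slot h k) - \<mu> (h k)) \<in> borel_measurable M"
    by (intro borel_measurable_sum borel_measurable_diff) auto
qed

text \<open>On each finite history of leaves the rewards are prescribed entries of the reward table, and
  the entry received in the last round is independent of \<open>U\<close> and of the other entries, which decide
  whether the history occurs.\<close>

lemma exp_process_expectation_le_1:
  assumes C: "\<And>k h h'. 1 \<le> k \<Longrightarrow> (\<And>j. j \<in> {1..k} \<Longrightarrow> h j = h' j) \<Longrightarrow> C k h = C k h'"
  shows "(\<integral>\<^sup>+\<omega>. exp_process (node_value D \<nu>) C t n (played \<omega>) (received \<omega>) \<partial>M) \<le> 1"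
proof (induction n)
  case 0
  then show ?case by (simp add: exp_process_def emeasure_space_1)
next
  case (Suc n)
  let ?\<mu> = "node_value D \<nu>"
  let ?W = "\<lambda>n \<omega>. ennreal (exp_process ?\<mu> C t n (played \<omega>) (received \<omega>))"
  let ?E = "history_event (Suc n)"
  let ?K = "\<lambda>h. slots - {slot h (Suc n)}"
  \<comment> \<open>\<open>F h\<close> is the process up to round \<open>n\<close> restricted to a
    history of length \<open>n + 1\<close>, a function of \<open>U\<close> and the entries other
    than the last one; \<open>g h\<close> is the factor of round \<open>n + 1\<close>.\<close>
  define F where "F h = (\<lambda>(u, y). if consistent (Suc n) h (u, y)
    then ennreal (exp_process ?\<mu> C t n h (\<lambda>k. y (slot h k))) else 0)" for h
  define g where "g h x = ennreal (if C (Suc n) h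
    then exp (t * (x - ?\<mu> (h (Suc n))) - t\<^sup>2 / 8) else 1)" for h x
  let ?P = "\<lambda>h \<omega>. F h (U \<omega>, restrict (sample \<omega>) (?K h))"
  have K: "slot h j \<in> ?K h" if "h \<in> histories (Suc n)" "1 \<le> j" "j \<le> n" for h j
    using slot_in_slots[of h "Suc n" j] slot_distinct[of j "Suc n" h] that by auto
  have past: "indicator (?E h) \<omega> * ?W n \<omega> = ?P h \<omega>"
    if "h \<in> histories (Suc n)" "\<omega> \<in> space M" for h \<omega>
  proof -
    have iff: "\<omega> \<in> ?E h \<longleftrightarrow> consistent (Suc n) h (U \<omega>, restrict (sample \<omega>) (?K h))"
      using that K by (intro history_event_iff) auto
    have "?W n \<omega> = ennreal (exp_process ?\<mu> C t n h (\<lambda>k. restrict (sample \<omega>) (?K h) (slot h k)))"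
      if "\<omega> \<in> ?E h"
      using that \<open>h \<in> histories (Suc n)\<close> K received_history[OF that]
      by (intro arg_cong[of _ _ ennreal] exp_process_cong C) (auto simp: history_event_def)
    then show ?thesis using iff by (simp add: F_def)
  qed
  have step: "indicator (?E h) \<omega> * ?W (Suc n) \<omega> = ?P h \<omega> * g h (sample \<omega> (slot h (Suc n)))"
    if "h \<in> histories (Suc n)" "\<omega> \<in> space M" for h \<omega>
  proof (cases "\<omega> \<in> ?E h")
    case True
    have "C (Suc n) (played \<omega>) = C (Suc n) h"
      using True by (intro C) (auto simp: history_event_def)
    moreover have "J (Suc n) \<omega> = h (Suc n)" using True by (auto simp: history_event_def)
    ultimately have "?W (Suc n) \<omega> = ?W n \<omega> * g h (sample \<omega> (slot h (Suc n)))"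
      using received_history[OF True, of "Suc n"]
      by (simp add: exp_process_Suc g_def exp_process_nonneg flip: ennreal_mult)
    then show ?thesis using past[OF that] True by simp
  next
    case False
    then show ?thesis using past[OF that] by simp
  qed
  have F [measurable]: "F h \<in> borel_measurable (S \<Otimes>\<^sub>M Pi\<^sub>M (?K h) (\<lambda>_. borel))"
    if h: "h \<in> histories (Suc n)" for h
  proof -
    have [measurable]: "Measurable.pred (S \<Otimes>\<^sub>M Pi\<^sub>M (?K h) (\<lambda>_. borel)) (consistent (Suc n) h)"
      using K h by (intro consistent_measurable) auto
    have y: "(\<lambda>p. snd p (slot h k)) \<in> borel_measurable (S \<Otimes>\<^sub>M Pi\<^sub>M (?K h) (\<lambda>_. borel))"
      if "k \<in> {1..n}" for k
      using K[OF h, of k] that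
      by (intro measurable_compose[OF measurable_snd measurable_component_singleton]) auto
    have "(\<lambda>p. if C k h then exp (t * (snd p (slot h k) - ?\<mu> (h k)) - t\<^sup>2 / 8) else 1)
        \<in> borel_measurable (S \<Otimes>\<^sub>M Pi\<^sub>M (?K h) (\<lambda>_. borel))" if "k \<in> {1..n}" for k
      using measurable_compose[OF y[OF that], of "\<lambda>x. exp (t * (x - ?\<mu> (h k)) - t\<^sup>2 / 8)" borel]
      by (cases "C k h") auto
    then have "(\<lambda>p. exp_process ?\<mu> C t n h (\<lambda>k. snd p (slot h k))) \<in>
        borel_measurable (S \<Otimes>\<^sub>M Pi\<^sub>M (?K h) (\<lambda>_. borel))"
      unfolding exp_process_def by (intro borel_measurable_prod) auto
    then have "(\<lambda>p. if consistent (Suc n) h p then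
        ennreal (exp_process ?\<mu> C t n h (\<lambda>k. snd p (slot h k))) else 0) \<in>
        borel_measurable (S \<Otimes>\<^sub>M Pi\<^sub>M (?K h) (\<lambda>_. borel))"
      by measurable
    then show ?thesis by (simp add: F_def case_prod_beta')
  qed
  have P [measurable]: "?P h \<in> borel_measurable M" if "h \<in> histories (Suc n)" for h
    by (rule measurable_compose[OF _ F[OF that]])
       (intro measurable_Pair U_measurable measurable_restrict sample_measurable; auto)
  have g [measurable]: "g h \<in> borel_measurable borel" for h
    unfolding g_def by (cases "C (Suc n) h") auto
  have gP: "(\<lambda>\<omega>. g h (sample \<omega> (slot h (Suc n)))) \<in> borel_measurable M"
    if "h \<in> histories (Suc n)" for h
    using slot_in_slots[OF that, of "Suc n"] sample_measurable by (intro measurable_compose[OF _ g]) auto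
  have g_le: "(\<integral>\<^sup>+\<omega>. g h (sample \<omega> (slot h (Suc n))) \<partial>M) \<le> 1" if "h \<in> histories (Suc n)" for h
  proof (cases "C (Suc n) h")
    case True
    have s: "slot h (Suc n) \<in> slots" using slot_in_slots[OF that, of "Suc n"] by simp
    show ?thesis
      using Hoeffdings_lemma_unit_interval[OF sample_measurable[OF s] sample_law(2)[OF s], of t]
        sample_law(1)[OF s] True by (simp add: g_def slot_def)
  qed (simp add: g_def emeasure_space_1)
  \<comment> \<open>Split over histories of length \<open>n + 1\<close>, separate the fresh factor
    in each piece, bound its integral by 1, and glue the pieces back together to the process at time
    \<open>n\<close>.\<close>
  have "(\<integral>\<^sup>+\<omega>. ?W (Suc n) \<omega> \<partial>M) =
      (\<integral>\<^sup>+\<omega>. (\<Sum>h\<in>histories (Suc n). ?P h \<omega> * g h (sample \<omega> (slot h (Suc n)))) \<partial>M)"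
    using step sum_histories[of _ "Suc n"] by (intro nn_integral_cong) (simp flip: step)
  also have "\<dots> = (\<Sum>h\<in>histories (Suc n). \<integral>\<^sup>+\<omega>. ?P h \<omega> * g h (sample \<omega> (slot h (Suc n))) \<partial>M)"
    using P gP by (intro nn_integral_sum) auto
  also have "\<dots> = (\<Sum>h\<in>histories (Suc n). (\<integral>\<^sup>+\<omega>. ?P h \<omega> \<partial>M) *
      (\<integral>\<^sup>+\<omega>. g h (sample \<omega> (slot h (Suc n))) \<partial>M))"
    using slot_in_slots[of _ "Suc n" "Suc n"] F g
    by (intro sum.cong refl nn_integral_fresh_sample) auto
  also have "\<dots> \<le> (\<Sum>h\<in>histories (Suc n). (\<integral>\<^sup>+\<omega>. ?P h \<omega> \<partial>M) * 1)"
    using g_le by (intro sum_mono mult_left_mono) auto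
  also have "\<dots> = (\<integral>\<^sup>+\<omega>. (\<Sum>h\<in>histories (Suc n). ?P h \<omega>) \<partial>M)"
    using P by (simp add: nn_integral_sum)
  also have "\<dots> = (\<integral>\<^sup>+\<omega>. ?W n \<omega> \<partial>M)"
    using past sum_histories[of _ "Suc n"] by (intro nn_integral_cong) (simp flip: past)
  also have "\<dots> \<le> 1" by (rule Suc.IH)
  finally show ?case .
qed

end

section \<open>Probability of large deviations\<close>

text \<open>The rounds counted here are the first \<open>m\<close> visits of \<open>i\<close>. Once
  these have happened their number is \<open>m\<close>, so the compensator of the exponential
  process is deterministic.\<close>

lemma card_stopped:
  "card {k \<in> {1..n}. prefix i (h k) \<and> visits h (k - 1) i < m} = min m (visits h n i)"
proof (induction n)
  case (Suc n)
  have "{k \<in> {1..Suc n}. prefix i (h k) \<and> visits h (k - 1) i < m} =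
      {k \<in> {1..n}. prefix i (h k) \<and> visits h (k - 1) i < m} \<union>
      (if prefix i (h (Suc n)) \<and> visits h n i < m then {Suc n} else {})"
    by (auto simp: le_Suc_eq)
  then show ?case using Suc by (auto simp: visits_Suc)
qed simp

lemma stopped_at:
  assumes "visits h n i = m"
  shows "{k \<in> {1..n}. prefix i (h k) \<and> visits h (k - 1) i < m} = {k \<in> {1..n}. prefix i (h k)}"
proof -
  have "visits h (k - 1) i < m" if "k \<in> {1..n}" "prefix i (h k)" for k
  proof -
    have "visits h (k - 1) i < visits h k i" using that visits_Suc[of h "k - 1" i] by simp
    also have "\<dots> \<le> m" using that assms visits_mono[of k n h i] by simp
    finally show ?thesis .
  qed
  then show ?thesis by auto
qed

lemma stopped_after:
  assumes "m \<le> visits h n i"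
  shows "{k \<in> {1..Suc n}. prefix i (h k) \<and> visits h (k - 1) i < m} =
    {k \<in> {1..n}. prefix i (h k) \<and> visits h (k - 1) i < m}"
  using assms by (auto simp: le_Suc_eq)

lemma nodes_finite_card: "finite (nodes D)" "card (nodes D) = num_nodes D"
proof -
  have eq: "nodes D = {xs. set xs \<subseteq> UNIV \<and> length xs \<le> D}" by (auto simp: nodes_def)
  show "finite (nodes D)" unfolding eq by (rule finite_lists_length_le) simp
  show "card (nodes D) = num_nodes D"
    unfolding eq by (subst card_lists_length_le) (simp_all add: num_nodes_def card_UNIV_bool sum_power2 atMost_atLeast0 flip: atLeastLessThanSuc_atLeastAtMost)
qed

context bandit
begin

text \<open>Chernoff's method for the sum stopped at the \<open>m\<close>-th visit, with the sign
  \<open>s\<close> choosing the side. Stopping handles all times \<open>n\<close> at once, without a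
  union bound over them.\<close>

lemma prob_stopped_deviation_le:
  fixes m :: nat and i :: node and c s :: real
  assumes c: "0 \<le> c" and s: "s\<^sup>2 = 1"
  defines "Z \<equiv> \<lambda>n \<omega>. \<Sum>k\<in>{k \<in> {1..n}. prefix i (J k \<omega>) \<and> visits (played \<omega>) (k - 1) i < m}.
      received \<omega> k - node_value D \<nu> (J k \<omega>)"
  defines "G \<equiv> \<lambda>n. {\<omega> \<in> space M. m \<le> visits (played \<omega>) n i \<and> real m * c \<le> s * Z n \<omega>}"
  shows "G n \<in> sets M" and "prob (\<Union>n. G n) \<le> exp (- 2 * real m * c\<^sup>2)"
proof -
  define C where "C = (\<lambda>k h. prefix i (h k) \<and> visits h (k - 1) i < m)"
  have C: "C k h = C k h'" if "1 \<le> k" "\<And>j. j \<in> {1..k} \<Longrightarrow> h j = h' j" for k h h'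
    using that visits_cong[of "k - 1" h h' i] by (force simp: C_def)
  have [measurable]: "Z n \<in> borel_measurable M" for n
    using weighted_sum_measurable[where C = C and n = n and \<mu> = "node_value D \<nu>", OF C] by (simp add: Z_def C_def)
  note [measurable] = visits_measurable
  show G: "G n \<in> sets M" for n unfolding G_def by measurable
  \<comment> \<open>The choice \<open>t = 4 * c * s\<close> maximises the exponent
    \<open>t * s * m * c - t\<^sup>2 * m / 8\<close>, with maximum
    \<open>2 * m * c\<^sup>2\<close>.\<close>
  define W where "W n \<omega> = exp_process (node_value D \<nu>) C (4 * c * s) n (played \<omega>) (received \<omega>)" for n \<omega>
  have W_eq: "W n \<omega> = exp (4 * c * s * Z n \<omega> - 2 * c\<^sup>2 * real (min m (visits (played \<omega>) n i)))" for n \<omega>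
    using card_stopped[of n i "played \<omega>" m] s
    by (simp add: W_def exp_process_eq C_def Z_def power_mult_distrib)
  have [measurable]: "W n \<in> borel_measurable M" for n
    unfolding W_eq[abs_def] by measurable
  have pointwise: "indicator (G n) \<omega> \<le> ennreal (exp (- 2 * real m * c\<^sup>2)) * ennreal (W n \<omega>)" for n \<omega>
  proof (cases "\<omega> \<in> G n")
    case True
    then have "min m (visits (played \<omega>) n i) = m" "real m * c \<le> s * Z n \<omega>" by (auto simp: G_def)
    moreover from this have "4 * c * (real m * c) \<le> 4 * c * (s * Z n \<omega>)"
      using c by (intro mult_left_mono) auto
    ultimately have "0 \<le> - 2 * real m * c\<^sup>2 + (4 * c * s * Z n \<omega> - 2 * c\<^sup>2 * real (min m (visits (played \<omega>) n i)))"
      by (simp add: power2_eq_square algebra_simps)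
    then have "1 \<le> exp (- 2 * real m * c\<^sup>2) * W n \<omega>"
      unfolding W_eq exp_add[symmetric] by simp
    then show ?thesis using True by (simp add: ennreal_1[symmetric] flip: ennreal_mult' del: ennreal_1)
  qed simp
  have P: "prob (G n) \<le> exp (- 2 * real m * c\<^sup>2)" for n
  proof -
    have "emeasure M (G n) = (\<integral>\<^sup>+\<omega>. indicator (G n) \<omega> \<partial>M)" using G by simp
    also have "\<dots> \<le> (\<integral>\<^sup>+\<omega>. ennreal (exp (- 2 * real m * c\<^sup>2)) * ennreal (W n \<omega>) \<partial>M)"
      by (intro nn_integral_mono pointwise)
    also have "\<dots> = ennreal (exp (- 2 * real m * c\<^sup>2)) * (\<integral>\<^sup>+\<omega>. ennreal (W n \<omega>) \<partial>M)"
      by (intro nn_integral_cmult) measurable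
    also have "\<dots> \<le> ennreal (exp (- 2 * real m * c\<^sup>2)) * 1"
      unfolding W_def by (intro mult_left_mono exp_process_expectation_le_1 C) auto
    finally show ?thesis by (simp add: emeasure_eq_measure)
  qed
  \<comment> \<open>After \<open>m\<close> visits the stopped sum no longer changes, so the events
    increase and the uniform bound passes to their union.\<close>
  have "incseq G"
  proof (rule incseq_SucI, rule subsetI)
    fix n \<omega> assume \<omega>: "\<omega> \<in> G n"
    then have "Z (Suc n) \<omega> = Z n \<omega>"
      using stopped_after[of m "played \<omega>" n i] by (simp add: G_def Z_def)
    then show "\<omega> \<in> G (Suc n)" using \<omega> by (simp add: G_def visits_Suc)
  qed
  then have "(\<lambda>n. prob (G n)) \<longlonglongrightarrow> prob (\<Union>n. G n)"
    using G by (intro finite_Lim_measure_incseq) auto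
  then show "prob (\<Union>n. G n) \<le> exp (- 2 * real m * c\<^sup>2)"
    using P by (intro LIMSEQ_le_const2) auto
qed

text \<open>A deviation at the \<open>m\<close>-th visit has probability at most
  \<open>\<beta> / (N * m * (m + 1))\<close> by the choice of \<open>dev_width\<close>; summed over
  \<open>m \<ge> 1\<close> this telescopes to \<open>\<beta> / N\<close>.\<close>

lemma deviation_event:
  assumes D: "1 \<le> D" and \<beta>: "0 < \<beta>" "\<beta> < 1" and s: "s\<^sup>2 = 1"
  shows "\<exists>B\<in>sets M. prob B \<le> \<beta> / real (num_nodes D) \<and> (\<forall>\<omega>\<in>space M - B. \<forall>n.
    visits (played \<omega>) n i \<noteq> 0 \<longrightarrow> s * centred_sum D \<nu> (played \<omega>) (\<lambda>l s. Y l s \<omega>) n i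
      \<le> real (visits (played \<omega>) n i) * dev_width D \<beta> (visits (played \<omega>) n i))"
proof -
  define Z where "Z m n \<omega> = (\<Sum>k\<in>{k \<in> {1..n}. prefix i (J k \<omega>) \<and> visits (played \<omega>) (k - 1) i < m}.
      received \<omega> k - node_value D \<nu> (J k \<omega>))" for m n \<omega>
  define G where "G m n = {\<omega> \<in> space M. m \<le> visits (played \<omega>) n i \<and>
      real m * dev_width D \<beta> m \<le> s * Z m n \<omega>}" for m n
  \<comment> \<open>The index is shifted because visit counts start at 1.\<close>
  define B where "B m = (\<Union>n. G (Suc m) n)" for m
  have G: "G m n \<in> sets M" if "1 \<le> m" for m n
    using prob_stopped_deviation_le(1)[OF dev_width_nonneg[OF D \<beta> that] s] by (simp add: G_def Z_def)
  have B: "B m \<in> sets M" for m unfolding B_def using G by (intro sets.countable_UN) auto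
  define N where "N = real (num_nodes D)"
  have N: "0 < N" using num_nodes_ge_3[OF D] by (simp add: N_def)
  have PB: "prob (B m) \<le> \<beta> / N * (1 / real (Suc m) - 1 / real (Suc (Suc m)))" for m
  proof -
    let ?Q = "N * real (Suc m) * (real (Suc m) + 1) / \<beta>"
    have Q: "1 < ?Q" using dev_width_arg[OF D \<beta>, of "Suc m"] by (simp add: N_def)
    then have dev: "2 * real (Suc m) * (dev_width D \<beta> (Suc m))\<^sup>2 = ln ?Q"
      unfolding dev_width_def N_def by (subst real_sqrt_pow2) auto
    have "prob (B m) \<le> exp (- 2 * real (Suc m) * (dev_width D \<beta> (Suc m))\<^sup>2)"
      using prob_stopped_deviation_le(2)[OF dev_width_nonneg[OF D \<beta>, of "Suc m"] s, of "Suc m" i]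
      by (simp add: B_def G_def Z_def)
    also have "\<dots> = exp (- ln ?Q)" unfolding dev[symmetric] by (simp only: mult_minus_left)
    also have "\<dots> = 1 / ?Q" using Q by (simp only: exp_minus exp_ln) (simp add: inverse_eq_divide)
    also have "\<dots> = \<beta> / N * (1 / real (Suc m) - 1 / real (Suc (Suc m)))"
      using N \<beta> by (simp add: divide_simps)
    finally show ?thesis .
  qed
  have "(\<lambda>n. 1 / real (Suc n)) \<longlonglongrightarrow> 0"
    using LIMSEQ_Suc[OF lim_1_over_n] by simp
  from sums_mult[OF telescope_sums'[OF this], of "\<beta> / N"]
  have sums: "(\<lambda>m. \<beta> / N * (1 / real (Suc m) - 1 / real (Suc (Suc m)))) sums (\<beta> / N)" by simp
  have summable: "summable (\<lambda>m. prob (B m))"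
    using PB by (intro summable_comparison_test[OF _ sums_summable[OF sums]]) (auto intro!: exI[of _ 0])
  have "prob (\<Union>m. B m) \<le> (\<Sum>m. prob (B m))"
    using B summable by (intro finite_measure_subadditive_countably) auto
  also have "\<dots> \<le> (\<Sum>m. \<beta> / N * (1 / real (Suc m) - 1 / real (Suc (Suc m))))"
    using PB summable sums_summable[OF sums] by (intro suminf_le) auto
  also have "\<dots> = \<beta> / N" using sums by (simp add: sums_iff)
  finally have "prob (\<Union>m. B m) \<le> \<beta> / real (num_nodes D)" by (simp add: N_def)
  moreover have "s * centred_sum D \<nu> (played \<omega>) (\<lambda>l s. Y l s \<omega>) n i
      \<le> real (visits (played \<omega>) n i) * dev_width D \<beta> (visits (played \<omega>) n i)"
    if \<omega>: "\<omega> \<in> space M - (\<Union>m. B m)" and m: "visits (played \<omega>) n i \<noteq> 0" for \<omega> n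
  proof -
    define m where "m = visits (played \<omega>) n i"
    obtain m' where "m = Suc m'" using m by (cases m) (auto simp: m_def)
    then have "\<omega> \<notin> G m n" using \<omega> by (auto simp: B_def)
    moreover have "Z m n \<omega> = centred_sum D \<nu> (played \<omega>) (\<lambda>l s. Y l s \<omega>) n i"
      using stopped_at[of "played \<omega>" n i m] by (simp add: Z_def centred_sum_def m_def)
    ultimately show ?thesis using \<omega> by (simp add: G_def flip: m_def)
  qed
  ultimately show ?thesis using B by (intro bexI[of _ "\<Union>m. B m"]) auto
qed

end

section \<open>Union bound over the nodes and conclusion\<close>

theorem theorem3:
  fixes M :: "'w measure" and S :: "'u measure"
    and D :: nat and \<beta> :: real and \<delta> :: "nat \<Rightarrow> real"
    and \<nu> :: "node \<Rightarrow> real measure"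
    and Y :: "node \<Rightarrow> nat \<Rightarrow> 'w \<Rightarrow> real"
    and U :: "'w \<Rightarrow> 'u"
    and J :: "nat \<Rightarrow> 'w \<Rightarrow> node"
  assumes "D \<ge> 1"
    and "0 < \<beta>" and "\<beta> < 1"
    and "\<And>d. d < D \<Longrightarrow> \<delta> d > 0"
    and "reward_model M D \<nu> Y"
    and "smooth_along_optimal_path D \<nu> \<delta>"
    and "non_anticipating M D Y S U J"
    and "\<And>\<omega>. \<omega> \<in> space M \<Longrightarrow> bast_run D \<delta> \<beta> (\<lambda>n. J n \<omega>) (\<lambda>l s. Y l s \<omega>)"
  shows "measure M {\<omega> \<in> space M. \<forall>n\<ge>1. \<forall>i\<in>nodes D. gap D \<nu> i > 0 \<longrightarrow>
           real (visits (\<lambda>m. J m \<omega>) n i) \<le> visit_bound D \<nu> \<delta> \<beta> i} \<ge> 1 - \<beta>"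
    (is "measure M ?good \<ge> _")
proof -
  interpret prob_space M using assms(5) by (simp add: reward_model_def)
  interpret bandit M D \<nu> Y S U J
    using assms(5,7,8) by unfold_locales (auto simp: bast_run_def)
  \<comment> \<open>One side per node: upward deviations for suboptimal nodes, downward ones for the
    rest. The \<open>num_nodes D\<close> bad events then cost \<open>\<beta>\<close> in
    total.\<close>
  define s :: "node \<Rightarrow> real" where "s i = (if 0 < gap D \<nu> i then 1 else -1)" for i
  have "\<forall>i. \<exists>B. B \<in> sets M \<and> prob B \<le> \<beta> / real (num_nodes D) \<and> (\<forall>\<omega>\<in>space M - B. \<forall>n.
    visits (played \<omega>) n i \<noteq> 0 \<longrightarrow> s i * centred_sum D \<nu> (played \<omega>) (\<lambda>l s. Y l s \<omega>) n i
      \<le> real (visits (played \<omega>) n i) * dev_width D \<beta> (visits (played \<omega>) n i))"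
    using deviation_event[OF assms(1-3)] by (auto simp: s_def Bex_def)
  from choice[OF this] obtain B where B: "\<And>i. B i \<in> sets M"
      "\<And>i. prob (B i) \<le> \<beta> / real (num_nodes D)"
    and dev: "\<And>i \<omega> n. \<omega> \<in> space M - B i \<Longrightarrow> visits (played \<omega>) n i \<noteq> 0 \<Longrightarrow>
      s i * centred_sum D \<nu> (played \<omega>) (\<lambda>l s. Y l s \<omega>) n i
        \<le> real (visits (played \<omega>) n i) * dev_width D \<beta> (visits (played \<omega>) n i)"
    by blast
  let ?bad = "\<Union>i\<in>nodes D. B i"
  have bad: "?bad \<in> sets M" using B(1) nodes_finite_card by (intro sets.finite_UN) auto
  have "prob ?bad \<le> (\<Sum>i\<in>nodes D. prob (B i))"
    using B(1) nodes_finite_card by (intro finite_measure_subadditive_finite) auto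
  also have "\<dots> \<le> real (card (nodes D)) * (\<beta> / real (num_nodes D))"
    using B(2) by (intro sum_bounded_above) auto
  also have "\<dots> = \<beta>" using num_nodes_ge_3[OF assms(1)] by (simp add: nodes_finite_card)
  finally have "1 - \<beta> \<le> prob (space M - ?bad)" using bad by (simp add: prob_compl)
  also have "\<dots> \<le> prob ?good"
  proof (rule finite_measure_mono)
    note [measurable] = visits_measurable
    show "?good \<in> sets M"
      using nodes_finite_card(1) by (intro predE pred_intros_countable pred_intros_finite) measurable
    show "space M - ?bad \<subseteq> ?good"
    proof
      fix \<omega> assume \<omega>: "\<omega> \<in> space M - ?bad"
      \<comment> \<open>The sample point is fixed from here on, and the deterministic half applies
        to it.\<close>
      interpret bast_execution D \<beta> \<delta> \<nu> "played \<omega>" "\<lambda>l s. Y l s \<omega>"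
      proof
        fix n i assume "i \<in> nodes D" and m: "visits (played \<omega>) n i \<noteq> 0"
        then have "\<omega> \<in> space M - B i" using \<omega> by auto
        note dev = dev[OF this m]
        show "centred_sum D \<nu> (played \<omega>) (\<lambda>l s. Y l s \<omega>) n i \<le>
            real (visits (played \<omega>) n i) * dev_width D \<beta> (visits (played \<omega>) n i)" if "0 < gap D \<nu> i"
          using dev that by (simp add: s_def)
        show "- centred_sum D \<nu> (played \<omega>) (\<lambda>l s. Y l s \<omega>) n i \<le>
            real (visits (played \<omega>) n i) * dev_width D \<beta> (visits (played \<omega>) n i)" if "gap D \<nu> i \<le> 0"
          using dev that by (simp add: s_def)
      qed (use assms \<omega> node_value_leaf_in in auto)
      show "\<omega> \<in> ?good" using \<omega> visits_le_visit_bound by simp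
    qed
  qed
  finally show ?thesis .
qed

end
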